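(* Let $P=P(n,m)$ be a graph chosen uniformly at random from the class of all planar graphs on vertex set $[n]=\{1,\dots,n\}$ with $m=m(n)$ edges, and let $r=r(n)$ be a vertex of $P$ chosen uniformly at random. Suppose $m\le n/2+O(n^{2/3})$ and $2m/n\to c\in[0,1]$. Then $(P,r)$ converges in the local weak sense to $T(c)$.
   Context: A rooted graph is a pair $(H,r)$ with $r\in V(H)$; two rooted graphs are isomorphic if there is a graph isomorphism mapping root to root. For $\ell\in\mathbb N$, $B_\ell(H,r)$ is the subgraph of $H$ induced by the vertices at distance at most $\ell$ from $r$, rooted at $r$. A sequence of random rooted graphs $G_n$ converges in the local weak sense to a random rooted graph $G_0$ if for every fixed finite rooted graph $(H,r_H)$ and every $\ell\in\mathbb N$, $\Pr[B_\ell(G_n)\cong(H,r_H)]\to\Pr[B_\ell(G_0)\cong(H,r_H)]$ as $n\to\infty$. $T(c)$ denotes the Galton–Watson tree with offspring distribution Poisson$(c)$, rooted at its ancestor. *)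

theory Defs
  imports "HOL-Probability.Probability"
begin

type_synonym 'a graph = "'a set \<times> 'a set set"

definition simple_graph :: "'a graph \<Rightarrow> bool" where
  "simple_graph G \<longleftrightarrow> (\<forall>e\<in>snd G. e \<subseteq> fst G \<and> card e = 2)"

definition planar :: "'a graph \<Rightarrow> bool" where
  "planar G \<longleftrightarrow> (\<exists>(f :: 'a \<Rightarrow> real^2) (\<gamma> :: 'a set \<Rightarrow> real \<Rightarrow> real^2).
      inj_on f (fst G) \<and>
      (\<forall>e\<in>snd G. arc (\<gamma> e) \<and> {pathstart (\<gamma> e), pathfinish (\<gamma> e)} = f ` e \<and>
                  path_image (\<gamma> e) \<inter> f ` fst G = f ` e) \<and>
      (\<forall>e\<in>snd G. \<forall>e'\<in>snd G. e \<noteq> e' \<longrightarrow>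
                  path_image (\<gamma> e) \<inter> path_image (\<gamma> e') = f ` (e \<inter> e')))"

definition within_dist :: "'a graph \<Rightarrow> 'a \<Rightarrow> nat \<Rightarrow> 'a \<Rightarrow> bool" where
  "within_dist G r l v \<longleftrightarrow> (\<exists>p. p \<noteq> [] \<and> length p \<le> Suc l \<and> hd p = r \<and> last p = v \<and>
      set p \<subseteq> fst G \<and> (\<forall>i. Suc i < length p \<longrightarrow> {p ! i, p ! Suc i} \<in> snd G))"

definition ball :: "'a graph \<Rightarrow> 'a \<Rightarrow> nat \<Rightarrow> 'a graph" where
  "ball G r l = (let W = {v \<in> fst G. within_dist G r l v} in (W, {e \<in> snd G. e \<subseteq> W}))"

definition rooted_iso :: "'a graph \<Rightarrow> 'a \<Rightarrow> 'b graph \<Rightarrow> 'b \<Rightarrow> bool" where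
  "rooted_iso G r H s \<longleftrightarrow> (\<exists>f. bij_betw f (fst G) (fst H) \<and> f r = s \<and>
      (\<forall>x\<in>fst G. \<forall>y\<in>fst G. {x, y} \<in> snd G \<longleftrightarrow> {f x, f y} \<in> snd H))"

text \<open>Ordered (plane) rooted trees; a vertex is addressed by the list of child
  indices on the path from the root (Ulam--Harris labelling).\<close>
datatype otree = Node "otree list"

fun addr_in :: "nat list \<Rightarrow> otree \<Rightarrow> bool" where
  "addr_in [] t = True"
| "addr_in (i # a) (Node ts) = (i < length ts \<and> addr_in a (ts ! i))"

definition tree_graph :: "otree \<Rightarrow> nat list graph" where
  "tree_graph t = ({a. addr_in a t}, {{a, a @ [i]} | a i. addr_in (a @ [i]) t})"

definition poisson_offspring :: "real \<Rightarrow> nat pmf" where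
  "poisson_offspring c = (if c = 0 then return_pmf 0 else poisson_pmf c)"

fun gw_tree :: "real \<Rightarrow> nat \<Rightarrow> otree pmf" where
  "gw_tree c 0 = return_pmf (Node [])"
| "gw_tree c (Suc l) = do { k \<leftarrow> poisson_offspring c; ts \<leftarrow> replicate_pmf k (gw_tree c l);
                           return_pmf (Node ts) }"

text \<open>Pr[B_l(T(c)) \<cong> (H, s)]; B_l(T(c)) only depends on the first l generations.\<close>
definition gw_ball_prob :: "real \<Rightarrow> nat \<Rightarrow> 'b graph \<Rightarrow> 'b \<Rightarrow> real" where
  "gw_ball_prob c l H s =
     measure_pmf.prob (gw_tree c l) {t. rooted_iso (ball (tree_graph t) [] l) [] H s}"

definition planar_graphs :: "nat \<Rightarrow> nat \<Rightarrow> nat set set set" where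
  "planar_graphs n m = {E. simple_graph ({1..n}, E) \<and> card E = m \<and> planar ({1..n}, E)}"

definition planar_ball_prob :: "nat \<Rightarrow> nat \<Rightarrow> nat \<Rightarrow> 'b graph \<Rightarrow> 'b \<Rightarrow> real" where
  "planar_ball_prob n m l H s =
     measure_pmf.prob (pmf_of_set (planar_graphs n m \<times> {1..n}))
       {(E, r). rooted_iso (ball ({1..n}, E) r l) r H s}"

end

theory Submission
  imports Defs "HOL-Real_Asymp.Real_Asymp"
begin

text \<open>
  Put \<open>p = 2m/n\<^sup>2\<close> and weight a set \<open>E\<close> of edges as in the binomial random graph with edge
  probability \<open>p\<close>; all graphs with \<open>m\<close> edges have the same weight. Forests are planar, and
  counting them shows that the planar graphs with \<open>m\<close> edges have total weight \<open>e\<^sup>-\<^sup>o\<^sup>(\<^sup>n\<^sup>)\<close>. On the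
  other hand, the number of vertices around which the graph looks like a given plane tree \<open>t\<close> changes
  by at most a constant when one edge is added, so it falls below its mean by \<open>\<epsilon>n\<close> only with
  probability \<open>e\<^sup>-\<^sup>\<Omega>\<^sup>(\<^sup>n\<^sup>)\<close>. Hence all but a vanishing fraction of the planar graphs see \<open>t\<close> at least
  as often as the binomial random graph, that is, with the asymptotic frequency that the
  Galton--Watson law gives to \<open>t\<close>. These lower bounds add up to \<open>1\<close>, so they are attained.
\<close>

section \<open>Counting forests\<close>

text \<open>The delicate density is \<open>c = 1\<close>. Up to \<open>(1 - 2\<delta>) n / 2\<close>
  edges, the component of a random vertex in a random forest has mean size at most
  \<open>1 / \<delta>\<close>, so almost every new edge keeps the graph a forest, and the weight
  loses only a factor depending on \<open>\<delta>\<close> and a factor of order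
  \<open>1 / n\<close>. The remaining edges, about \<open>2\<delta>n\<close> at most, are added
  crudely: linearly many components are left, a constant fraction of all pairs can still be joined,
  and the cost is \<open>e^(-O(\<delta>n))\<close>. As \<open>\<delta>\<close> is arbitrary, this is
  \<open>e^(-o(n))\<close>; no precise enumeration near the critical density is involved.

  The concentration bound has to exploit that \<open>p\<close> is small. There are about
  \<open>n^2 / 2\<close> independent edges, and an inequality charging each of them the full squared
  change would only give a tail of constant order. Charging the variance, of order \<open>p\<close>
  per edge, gives a total of order \<open>n\<close> and hence an exponentially small tail.\<close>

definition conn :: "'a set set \<Rightarrow> 'a \<Rightarrow> 'a \<Rightarrow> bool" where
  "conn E u v \<longleftrightarrow> (u, v) \<in> {(x, y). {x, y} \<in> E}\<^sup>*"

text \<open>Acyclicity stated as: every edge is a bridge. No cycles have to be handled, subsets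
  inherit the property by monotonicity of \<open>conn\<close>, and degenerate edges
  \<open>{x, x}\<close> are excluded because \<open>conn\<close> is reflexive.\<close>

definition forest :: "'a set set \<Rightarrow> bool" where
  "forest E \<longleftrightarrow> (\<forall>x y. {x, y} \<in> E \<longrightarrow> \<not> conn (E - {{x, y}}) x y)"

lemma conn_refl [simp]: "conn E u u"
  by (simp add: conn_def)

lemma conn_trans: "conn E u v \<Longrightarrow> conn E v w \<Longrightarrow> conn E u w"
  unfolding conn_def by (rule rtrancl_trans)

lemma conn_edge: "{u, v} \<in> E \<Longrightarrow> conn E u v"
  unfolding conn_def by auto

lemma conn_sym: "conn E u v \<Longrightarrow> conn E v u"
proof -
  have "sym {(x, y). {x, y} \<in> E}"
    by (auto simp: sym_def insert_commute)
  then show "conn E u v \<Longrightarrow> conn E v u"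
    unfolding conn_def by (metis sym_rtrancl symE)
qed

lemma conn_mono: "conn E u v \<Longrightarrow> E \<subseteq> E' \<Longrightarrow> conn E' u v"
  unfolding conn_def by (rule rtrancl_mono[THEN subsetD]) auto

lemma conn_induct [consumes 1, case_names refl step]:
  assumes "conn E u v" "P u"
    and "\<And>x y. conn E u x \<Longrightarrow> {x, y} \<in> E \<Longrightarrow> P x \<Longrightarrow> P y"
  shows "P v"
  using assms(1) unfolding conn_def
  by (induction rule: rtrancl_induct) (use assms in \<open>auto simp: conn_def\<close>)

lemma conn_empty [simp]: "conn {} u v \<longleftrightarrow> u = v"
  by (auto simp: conn_def)

lemma conn_insert:
  assumes "conn (insert {x, y} E) u v"
  shows "conn E u v \<or> conn E u x \<and> conn E y v \<or> conn E u y \<and> conn E x v"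
  using assms
proof (induction rule: conn_induct)
  case refl
  then show ?case by simp
next
  case (step a b)
  show ?case
  proof (cases "{a, b} \<in> E")
    case True
    then show ?thesis using step.IH conn_trans conn_edge by metis
  next
    case False
    then have "a = x \<and> b = y \<or> a = y \<and> b = x"
      using step.hyps(2) by (auto simp: doubleton_eq_iff)
    then show ?thesis using step.IH by auto
  qed
qed

text \<open>The walk is cut at a departure from \<open>u\<close>: the induction restarts whenever
  the walk stands at \<open>u\<close>, and a step back along \<open>{u, w}\<close> ends at
  \<open>u\<close>, which is the first alternative. Being able to delete \<open>{u, w}\<close> and
  keep the rest is what relates forests with \<open>k + 1\<close> and with \<open>k\<close>
  edges.\<close>

lemma conn_first_edge:
  assumes "conn E u v"
  shows "v = u \<or> (\<exists>w. {u, w} \<in> E \<and> conn (E - {{u, w}}) w v)"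
  using assms
proof (induction rule: conn_induct)
  case refl
  then show ?case by simp
next
  case (step a b)
  show ?case
  proof (cases "a = u")
    case True
    then show ?thesis using step.hyps(2) by (metis conn_refl)
  next
    case False
    then obtain w where w: "{u, w} \<in> E" "conn (E - {{u, w}}) w a"
      using step.IH by auto
    show ?thesis
    proof (cases "{a, b} = {u, w}")
      case True
      then show ?thesis using \<open>a \<noteq> u\<close> by (auto simp: doubleton_eq_iff)
    next
      case False
      then have "conn (E - {{u, w}}) a b" using step.hyps(2) by (auto intro: conn_edge)
      then show ?thesis using w conn_trans by metis
    qed
  qed
qed

lemma forest_empty [simp]: "forest {}"
  by (simp add: forest_def)

lemma forest_subset: "forest E \<Longrightarrow> E' \<subseteq> E \<Longrightarrow> forest E'"
  unfolding forest_def by (meson Diff_mono conn_mono subset_refl subsetD)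

text \<open>An old edge \<open>{a, b}\<close> could stop being a bridge only through the new edge;
  the detour, together with \<open>{a, b}\<close> itself, would then join \<open>x\<close> to
  \<open>y\<close> inside \<open>E\<close>.\<close>

lemma forest_insert:
  assumes "forest E" "\<not> conn E x y"
  shows "forest (insert {x, y} E)"
  unfolding forest_def
proof (intro allI impI notI)
  fix a b assume ab: "{a, b} \<in> insert {x, y} E"
    and c: "conn (insert {x, y} E - {{a, b}}) a b"
  have nE: "{x, y} \<notin> E" using assms(2) conn_edge by metis
  show False
  proof (cases "{a, b} = {x, y}")
    case True
    then have "conn E a b" using c nE by (simp add: insert_absorb)
    then show False using True assms(2) conn_sym by (metis doubleton_eq_iff)
  next
    case False
    then have abE: "{a, b} \<in> E" using ab by simp
    have "insert {x, y} E - {{a, b}} = insert {x, y} (E - {{a, b}})" using False by auto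
    then consider "conn (E - {{a, b}}) a b" | "conn (E - {{a, b}}) a x" "conn (E - {{a, b}}) y b"
      | "conn (E - {{a, b}}) a y" "conn (E - {{a, b}}) x b"
      using conn_insert c by metis
    then have "conn E x y"
    proof cases
      case 1
      then show ?thesis using assms(1) abE unfolding forest_def by auto
    next
      case 2
      then have "conn E a x" "conn E y b" "conn E a b"
        using abE by (auto intro: conn_mono conn_edge)
      then show ?thesis by (meson conn_sym conn_trans)
    next
      case 3
      then have "conn E a y" "conn E x b" "conn E a b"
        using abE by (auto intro: conn_mono conn_edge)
      then show ?thesis by (meson conn_sym conn_trans)
    qed
    then show False using assms(2) by simp
  qed
qed

text \<open>\<open>I\<close> acts as a set of representatives of components. A new edge merges at
  most two of them, and dropping the representative connected to \<open>x\<close> repairs the set at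
  the cost of one element.\<close>

lemma unconnected_set:
  assumes "finite V" "finite E" "\<forall>e\<in>E. card e = 2"
  shows "\<exists>I\<subseteq>V. card V \<le> card I + card E \<and> (\<forall>u\<in>I. \<forall>v\<in>I. u \<noteq> v \<longrightarrow> \<not> conn E u v)"
  using assms(2,3)
proof (induction E rule: finite_induct)
  case empty
  then show ?case by auto
next
  case (insert e E)
  obtain x y where e: "e = {x, y}" using insert.prems by (auto simp: card_2_iff)
  obtain I where I: "I \<subseteq> V" "card V \<le> card I + card E"
      "\<forall>u\<in>I. \<forall>v\<in>I. u \<noteq> v \<longrightarrow> \<not> conn E u v"
    using insert by auto
  have finI: "finite I" using I(1) assms(1) finite_subset by auto
  define J where "J = I - {u. conn E u x}"
  have "card I \<le> card J + 1"
  proof (cases "\<exists>u\<in>I. conn E u x")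
    case True
    then obtain u where u: "u \<in> I" "conn E u x" by auto
    then have "I \<subseteq> insert u J" using I(3) conn_sym[of E] conn_trans[of E] unfolding J_def by (smt (verit) DiffI insertCI mem_Collect_eq subsetI)
    then have "card I \<le> card (insert u J)" using finI by (intro card_mono) (auto simp: J_def)
    also have "\<dots> \<le> card J + 1" using card_insert_le_m1 finI
      by (simp add: J_def card_insert_if)
    finally show ?thesis .
  next
    case False
    then have "J = I" by (auto simp: J_def)
    then show ?thesis by simp
  qed
  moreover have "\<forall>u\<in>J. \<forall>v\<in>J. u \<noteq> v \<longrightarrow> \<not> conn (insert e E) u v"
    using I(3) conn_insert[of x y E] conn_sym[of E] unfolding J_def e by (metis DiffD1 DiffD2 mem_Collect_eq)
  ultimately show ?case
    using I insert.hyps by (intro exI[of _ J]) (auto simp: J_def)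
qed

section \<open>Recursions between forests with k and k + 1 edges\<close>

definition edges_on :: "'a set \<Rightarrow> 'a set set" where
  "edges_on V = {e. e \<subseteq> V \<and> card e = 2}"

lemma finite_edges_on: "finite V \<Longrightarrow> finite (edges_on V)"
  unfolding edges_on_def by (rule finite_subset[of _ "Pow V"]) auto

definition forests :: "'a set \<Rightarrow> nat \<Rightarrow> 'a set set set" where
  "forests V k = {E. E \<subseteq> edges_on V \<and> card E = k \<and> forest E}"

text \<open>Ordered pairs, diagonal included. For a forest \<open>E\<close> the complement in
  \<open>V \<times> V\<close> consists exactly of the pairs whose edge can be added to give a forest
  with one more edge.\<close>

definition conn_pairs :: "'a set \<Rightarrow> 'a set set \<Rightarrow> ('a \<times> 'a) set" where
  "conn_pairs V E = {(u, v). u \<in> V \<and> v \<in> V \<and> conn E u v}"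

text \<open>Divided by the number of forests and by \<open>card V\<close>, this is the mean size of
  the component of a random vertex in a random forest with \<open>k\<close> edges.\<close>

definition total_conn :: "'a set \<Rightarrow> nat \<Rightarrow> nat" where
  "total_conn V k = (\<Sum>E\<in>forests V k. card (conn_pairs V E))"

context
  fixes V :: "'a set"
  assumes V: "finite V"
begin

lemma finite_forests [simp]: "finite (forests V k)"
proof (rule finite_subset)
  show "forests V k \<subseteq> Pow (edges_on V)" by (auto simp: forests_def)
qed (simp add: finite_edges_on V)

lemma finite_conn_pairs [simp]: "finite (conn_pairs V E)"
proof (rule finite_subset)
  show "conn_pairs V E \<subseteq> V \<times> V" by (auto simp: conn_pairs_def)
qed (simp add: V)

lemma finite_forestD:
  assumes "E \<in> forests V k"
  shows "finite E"
proof (rule finite_subset)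
  show "E \<subseteq> edges_on V" using assms by (simp add: forests_def)
qed (rule finite_edges_on[OF V])

lemma total_conn_card: "total_conn V k = card (SIGMA E : forests V k. conn_pairs V E)"
  unfolding total_conn_def by (subst card_SigmaI) auto

text \<open>Double counting: joining an unconnected ordered pair of a forest with \<open>k\<close>
  edges gives a forest with \<open>k + 1\<close> edges and an orientation of one of its edges. These
  data determine the original forest and pair, and each larger forest offers at most
  \<open>2 * Suc k\<close> of them.\<close>

lemma card_forests_Suc:
  "card V ^ 2 * card (forests V k) \<le> 2 * Suc k * card (forests V (Suc k)) + total_conn V k"
proof -
  let ?D = "SIGMA E : forests V k. (V \<times> V - conn_pairs V E)"
  let ?T = "SIGMA E : forests V (Suc k). (\<Union>e\<in>E. {(u, v). e = {u, v}})"
  let ?h = "\<lambda>(E, u, v). (insert {u, v} E, u, v)"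
  have fin: "finite (V \<times> V)" using V by simp
  have two: "finite {(u, v). e = {u, v}} \<and> card {(u, v). e = {u, v}} = 2" if "card e = 2" for e :: "'a set"
  proof -
    obtain x y where "e = {x, y}" "x \<noteq> y" using \<open>card e = 2\<close> by (auto simp: card_2_iff)
    then have "{(u, v). e = {u, v}} = {(x, y), (y, x)}" by (auto simp: doubleton_eq_iff)
    then show ?thesis using \<open>x \<noteq> y\<close> by auto
  qed
  have inj: "inj_on ?h ?D"
  proof (rule inj_onI)
    fix x y assume x: "x \<in> ?D" and y: "y \<in> ?D" and eq: "?h x = ?h y"
    obtain E u v E' where xy: "x = (E, u, v)" "y = (E', u, v)"
      using eq by (cases x, cases y) auto
    have *: "u \<in> V" "v \<in> V" "insert {u, v} E = insert {u, v} E'"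
      "(u, v) \<notin> conn_pairs V E" "(u, v) \<notin> conn_pairs V E'"
      using x y eq unfolding xy by auto
    have "{u, v} \<notin> E" "{u, v} \<notin> E'"
      using * conn_edge unfolding conn_pairs_def by fastforce+
    then show "x = y" using *(3) xy by (metis Diff_insert_absorb)
  qed
  have sub: "?h ` ?D \<subseteq> ?T"
  proof (rule subsetI, elim imageE)
    fix z x assume z: "z = ?h x" and x: "x \<in> ?D"
    obtain E u v where xe: "x = (E, u, v)" by (metis prod.collapse)
    have *: "E \<in> forests V k" "u \<in> V" "v \<in> V" "(u, v) \<notin> conn_pairs V E"
      using x unfolding xe by auto
    from * have nc: "\<not> conn E u v" by (auto simp: conn_pairs_def)
    then have "u \<noteq> v" "{u, v} \<notin> E" using conn_edge[of u v E] by auto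
    then have "insert {u, v} E \<in> forests V (Suc k)"
      using * forest_insert[OF _ nc] finite_forestD[OF *(1)]
      unfolding forests_def edges_on_def by auto
    then show "z \<in> ?T" unfolding z xe by auto
  qed
  have finE: "finite E" "\<forall>e\<in>E. card e = 2" "card E = Suc k" if "E \<in> forests V (Suc k)" for E
    using finite_forestD[OF that] that unfolding forests_def edges_on_def by auto
  have cE: "card (\<Union>e\<in>E. {(u, v). e = {u, v}}) \<le> 2 * Suc k" if "E \<in> forests V (Suc k)" for E
  proof -
    have "card (\<Union>e\<in>E. {(u, v). e = {u, v}}) \<le> (\<Sum>e\<in>E. card {(u, v). e = {u, v}})"
      using finE[OF that] by (intro card_UN_le) auto
    also have "\<dots> = (\<Sum>e\<in>E. 2)" using finE[OF that] two by (intro sum.cong) auto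
    finally show ?thesis using finE[OF that] by simp
  qed
  have finT: "finite ?T" using finE two by (intro finite_SigmaI) auto
  have "card ?D = (\<Sum>E\<in>forests V k. card (V \<times> V - conn_pairs V E))"
    using fin by (subst card_SigmaI) auto
  also have "\<dots> = (\<Sum>E\<in>forests V k. card V ^ 2 - card (conn_pairs V E))"
    by (intro sum.cong refl, subst card_Diff_subset)
       (auto simp: conn_pairs_def card_cartesian_product power2_eq_square V intro: finite_subset[OF _ fin])
  finally have D: "card ?D = (\<Sum>E\<in>forests V k. card V ^ 2 - card (conn_pairs V E))" .
  have "card V ^ 2 * card (forests V k) = (\<Sum>E\<in>forests V k. card V ^ 2)" by simp
  \<comment> \<open>The subtraction is truncated on \<open>nat\<close>;
    \<open>a \<le> (a - b) + b\<close> holds in any case.\<close>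
  also have "\<dots> \<le> (\<Sum>E\<in>forests V k. (card V ^ 2 - card (conn_pairs V E)) + card (conn_pairs V E))"
    by (intro sum_mono) auto
  also have "\<dots> = card ?D + total_conn V k"
    unfolding D total_conn_def by (simp add: sum.distrib)
  also have "card ?D \<le> card ?T" by (rule card_inj_on_le[OF inj sub finT])
  also have "card ?T = (\<Sum>E\<in>forests V (Suc k). card (\<Union>e\<in>E. {(u, v). e = {u, v}}))"
    using finE two by (subst card_SigmaI) auto
  also have "\<dots> \<le> (\<Sum>E\<in>forests V (Suc k). 2 * Suc k)" by (intro sum_mono cE)
  also have "\<dots> = 2 * Suc k * card (forests V (Suc k))" by simp
  finally show ?thesis by simp
qed

text \<open>Deleting the first edge of a path from \<open>u\<close> to \<open>v\<close> gives a smaller forest connecting \<open>w\<close> to \<open>v\<close>.\<close>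
lemma total_conn_Suc:
  "total_conn V (Suc k) \<le> card V * card (forests V (Suc k)) + card V * total_conn V k"
proof -
  let ?S = "SIGMA E : forests V (Suc k). conn_pairs V E"
  let ?S1 = "(\<lambda>(E, u). (E, u, u)) ` (forests V (Suc k) \<times> V)"
  let ?S2 = "{(E, u, v). (E, u, v) \<in> ?S \<and> u \<noteq> v}"
  let ?T = "(SIGMA E : forests V k. conn_pairs V E) \<times> V"
  define w where "w E u v = (SOME w. {u, w} \<in> E \<and> conn (E - {{u, w}}) w v)" for E and u v :: 'a
  let ?h = "\<lambda>(E, u, v). ((E - {{u, w E u v}}, (w E u v, v)), u)"
  have w: "{u, w E u v} \<in> E" "conn (E - {{u, w E u v}}) (w E u v) v" if "(E, u, v) \<in> ?S2" for E u v
  proof -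
    have "\<exists>w. {u, w} \<in> E \<and> conn (E - {{u, w}}) w v"
      using that conn_first_edge[of E u v] by (auto simp: conn_pairs_def)
    from someI_ex[OF this] show "{u, w E u v} \<in> E" "conn (E - {{u, w E u v}}) (w E u v) v"
      unfolding w_def by auto
  qed
  have inj: "inj_on ?h ?S2"
  proof (rule inj_onI)
    fix x y assume x: "x \<in> ?S2" and y: "y \<in> ?S2" and eq: "?h x = ?h y"
    obtain E u v E' u' v' where xy: "x = (E, u, v)" "y = (E', u', v')" by (metis prod.collapse)
    have "insert {u, w E u v} (E - {{u, w E u v}}) = E"
      "insert {u', w E' u' v'} (E' - {{u', w E' u' v'}}) = E'"
      using w(1) x y xy by blast+
    moreover have uv: "u = u'" "v = v'" using eq unfolding xy by simp_all
    moreover have "E - {{u, w E u v}} = E' - {{u', w E' u' v'}} \<and> w E u v = w E' u' v'"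
      using eq unfolding xy uv prod.case prod.inject by blast
    ultimately show "x = y" unfolding xy by metis
  qed
  have sub: "?h ` ?S2 \<subseteq> ?T"
  proof (rule subsetI, elim imageE)
    fix z x assume z: "z = ?h x" and x: "x \<in> ?S2"
    obtain E u v where xe: "x = (E, u, v)" by (metis prod.collapse)
    have E: "E \<in> forests V (Suc k)" and uv: "u \<in> V" "v \<in> V"
      using x unfolding xe conn_pairs_def by auto
    have ww: "{u, w E u v} \<in> E" "conn (E - {{u, w E u v}}) (w E u v) v" using w x xe by blast+
    have "w E u v \<in> V" using ww(1) E unfolding forests_def edges_on_def by auto
    moreover have "E - {{u, w E u v}} \<in> forests V k"
      using E ww(1) finite_forestD[OF E] unfolding forests_def
      by (auto intro: forest_subset)
    ultimately show "z \<in> ?T" using uv ww(2) unfolding z xe conn_pairs_def by auto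
  qed
  have "total_conn V (Suc k) = card ?S" by (rule total_conn_card)
  also have "\<dots> \<le> card (?S1 \<union> ?S2)"
  proof (rule card_mono)
    show "finite (?S1 \<union> ?S2)"
      using V by (intro finite_UnI finite_imageI finite_cartesian_product finite_subset[of ?S2 ?S] finite_SigmaI) auto
  qed (auto simp: conn_pairs_def)
  also have "\<dots> \<le> card ?S1 + card ?S2" by (rule card_Un_le)
  also have "card ?S1 \<le> card (forests V (Suc k) \<times> V)" by (rule card_image_le) (simp add: V)
  also have "card ?S2 \<le> card ?T"
    using V by (intro card_inj_on_le[OF inj sub]) auto
  also have "card ?T = total_conn V k * card V"
    by (simp add: card_cartesian_product total_conn_card)
  finally show ?thesis by (simp add: card_cartesian_product mult.commute)
qed

text \<open>There are at least \<open>card V - k\<close> mutually unconnected vertices, hence many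
  ordered pairs that can still be joined. Crude, but valid at every density; it serves beyond the
  point where the subcritical induction stops.\<close>

lemma total_conn_le:
  assumes "k \<le> card V"
  shows "total_conn V k + (card V - k) * (card V - k - 1) * card (forests V k) \<le> card V ^ 2 * card (forests V k)"
proof -
  have "card (conn_pairs V E) + (card V - k) * (card V - k - 1) \<le> card V ^ 2" if E: "E \<in> forests V k" for E
  proof -
    have "finite E" "\<forall>e\<in>E. card e = 2" "card E = k"
      using finite_forestD[OF E] E unfolding forests_def edges_on_def by auto
    then obtain I where I: "I \<subseteq> V" "card V \<le> card I + k" "\<forall>u\<in>I. \<forall>v\<in>I. u \<noteq> v \<longrightarrow> \<not> conn E u v"
      using unconnected_set[OF V, of E] by auto
    have finI: "finite I" using I(1) V finite_subset by auto
    let ?D = "I \<times> I - (\<lambda>u. (u, u)) ` I"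
    have "card ?D = card (I \<times> I) - card ((\<lambda>u. (u, u)) ` I)"
      using finI by (intro card_Diff_subset) auto
    also have "card ((\<lambda>u. (u, u)) ` I) = card I" by (intro card_image) (auto simp: inj_on_def)
    finally have D: "card ?D = card I * (card I - 1)"
      by (simp add: card_cartesian_product diff_mult_distrib2)
    have "card (conn_pairs V E) + card ?D = card (conn_pairs V E \<union> ?D)"
      using finI I(3) by (intro card_Un_disjoint[symmetric] finite_conn_pairs) (auto simp: conn_pairs_def)
    also have "\<dots> \<le> card (V \<times> V)"
      using I(1) V by (intro card_mono) (auto simp: conn_pairs_def)
    finally have "card (conn_pairs V E) + card I * (card I - 1) \<le> card V ^ 2"
      by (simp add: D card_cartesian_product power2_eq_square)
    moreover have "(card V - k) * (card V - k - 1) \<le> card I * (card I - 1)"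
      using I(2) by (intro mult_mono) auto
    ultimately show ?thesis by linarith
  qed
  then have "(\<Sum>E\<in>forests V k. card (conn_pairs V E) + (card V - k) * (card V - k - 1)) \<le> (\<Sum>E\<in>forests V k. card V ^ 2)"
    by (rule sum_mono)
  then show ?thesis
    unfolding total_conn_def sum.distrib sum_constant by (simp only: mult.commute[of "card (forests V k)"] of_nat_id)
qed

end

lemma forests_0 [simp]:
  assumes "finite V"
  shows "forests V 0 = {{}}"
proof (intro set_eqI iffI)
  fix E assume E: "E \<in> forests V 0"
  then have "card E = 0" by (simp add: forests_def)
  then show "E \<in> {{}}" using finite_forestD[OF assms E] by simp
qed (simp add: forests_def)

section \<open>Total weight of the forests\<close>

lemma one_minus_ge_exp:
  fixes x :: real
  assumes "0 \<le> x" "x \<le> 1 / 2"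
  shows "exp (- x - 2 * x\<^sup>2) \<le> 1 - x"
proof -
  have "- x - 2 * x\<^sup>2 \<le> ln (1 - x)" using ln_one_minus_pos_lower_bound[OF assms] by simp
  then have "exp (- x - 2 * x\<^sup>2) \<le> exp (ln (1 - x))" by simp
  then show ?thesis using assms by simp
qed

lemma fact_le_power: "fact m * exp (real m) \<le> exp 1 * real (max m 1) * real m ^ m"
proof (induction m)
  case 0
  then show ?case by simp
next
  case (Suc m)
  show ?case
  proof (cases "m = 0")
    case True
    then show ?thesis by simp
  next
    case False
    define x :: real where "x = real m"
    have x: "x > 0" using False by (simp add: x_def)
    have mm: "max m 1 = m" using False by simp
    have "ln (x / (x + 1)) \<le> x / (x + 1) - 1" using x by (intro ln_le_minus_one) auto
    also have "\<dots> = - 1 / (x + 1)" using x by (simp add: field_simps)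
    finally have "1 \<le> (x + 1) * ln ((x + 1) / x)" using x by (simp add: ln_div field_simps)
    also have "\<dots> = ln (((x + 1) / x) ^ Suc m)" using x by (simp only: ln_realpow) (simp add: x_def add.commute)
    finally have "exp 1 \<le> ((x + 1) / x) ^ Suc m" using x by (simp add: ln_ge_iff del: power_Suc)
    then have e: "exp 1 * x ^ Suc m \<le> (x + 1) ^ Suc m"
      using x by (simp add: power_divide pos_le_divide_eq del: power_Suc)
    have "fact (Suc m) * exp (real (Suc m)) = (x + 1) * exp 1 * (fact m * exp x)"
      by (simp add: x_def exp_add algebra_simps)
    also have "\<dots> \<le> (x + 1) * exp 1 * (exp 1 * x * x ^ m)"
      using Suc.IH x unfolding mm by (intro mult_left_mono) (auto simp: x_def)
    also have "\<dots> = (x + 1) * exp 1 * (exp 1 * x ^ Suc m)" by simp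
    also have "\<dots> \<le> (x + 1) * exp 1 * (x + 1) ^ Suc m"
      using e x by (intro mult_left_mono) auto
    finally show ?thesis by (simp add: x_def add.commute mult.commute mult.left_commute)
  qed
qed

context
  fixes V :: "'a set" and n :: nat
  assumes V: "finite V" and n: "card V = n"
begin

text \<open>If on average at most a fraction \<open>1 - x\<close> of the ordered pairs is connected,
  the remaining pairs bound the growth of the count from below. Both ranges of edge numbers use
  this, with different \<open>x\<close>.\<close>

lemma card_forests_ratio:
  assumes "real (total_conn V k) \<le> (1 - x) * real n ^ 2 * real (card (forests V k))"
  shows "x * real n ^ 2 * real (card (forests V k)) \<le> 2 * real (Suc k) * real (card (forests V (Suc k)))"
proof -
  have "real (n ^ 2 * card (forests V k)) \<le> real (2 * Suc k * card (forests V (Suc k)) + total_conn V k)"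
    using card_forests_Suc[OF V, of k] unfolding n of_nat_le_iff .
  then have "real n ^ 2 * real (card (forests V k)) \<le> 2 * real (Suc k) * real (card (forests V (Suc k))) + real (total_conn V k)"
    by (simp only: of_nat_add of_nat_mult of_nat_power of_nat_numeral)
  then show ?thesis using assms by (simp add: algebra_simps)
qed

text \<open>The bound says that mean component sizes are at most \<open>1 / \<delta>\<close>. The
  hypothesis for \<open>k\<close> yields
  \<open>real n * ?f k \<le> (1 - \<delta>) * ?f (Suc k)\<close>; inserted into
  \<open>total_conn_Suc\<close>, it closes the induction because
  \<open>1 + (1 - \<delta>) / \<delta> = 1 / \<delta>\<close>.\<close>

lemma total_conn_subcritical:
  assumes \<delta>: "0 < \<delta>" "\<delta> < 1" "1 \<le> \<delta>\<^sup>2 * real n" and k: "2 * real k \<le> (1 - 2 * \<delta>) * real n"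
  shows "\<delta> * real (total_conn V k) \<le> real n * real (card (forests V k))"
  using k
proof (induction k)
  case 0
  have "conn_pairs V {} = (\<lambda>v. (v, v)) ` V" by (auto simp: conn_pairs_def)
  then have "card (conn_pairs V {}) = n" using n by (simp add: card_image inj_on_def)
  then have "total_conn V 0 = n" using V by (simp add: total_conn_def)
  then show ?case using \<delta>(2) V by (simp add: mult_left_le_one_le \<delta>(1) less_imp_le)
next
  case (Suc k)
  let ?f = "\<lambda>k. real (card (forests V k))" and ?T = "\<lambda>k. real (total_conn V k)"
  have n0: "real n > 0" using \<delta> by (metis mult_zero_right not_gr_zero of_nat_0 of_nat_0_less_iff not_one_le_zero)
  have IH: "\<delta> * ?T k \<le> real n * ?f k" using Suc by simp
  have dn: "1 \<le> \<delta> * real n"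
  proof -
    have "\<delta>\<^sup>2 * real n \<le> \<delta> * real n" using \<delta> by (intro mult_right_mono) (auto simp: power2_eq_square)
    then show ?thesis using \<delta>(3) by linarith
  qed
  have "?T k \<le> real n * ?f k / \<delta>" using IH \<delta>(1) by (simp add: field_simps)
  also have "\<dots> = (1 - (1 - 1 / (\<delta> * real n))) * real n ^ 2 * ?f k"
    using n0 \<delta>(1) by (simp add: field_simps power2_eq_square)
  finally have "(1 - 1 / (\<delta> * real n)) * real n ^ 2 * ?f k \<le> 2 * real (Suc k) * ?f (Suc k)"
    by (rule card_forests_ratio)
  also have "\<dots> \<le> (1 - 2 * \<delta>) * real n * ?f (Suc k)" using Suc.prems by (intro mult_right_mono) auto
  \<comment> \<open>The gap between \<open>2 * \<delta>\<close> in the edge bound and the wanted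
    \<open>\<delta>\<close> pays for the factor \<open>1 - 1 / (\<delta> * real n)\<close>, by
    \<open>1 \<le> \<delta>\<^sup>2 * real n\<close>.\<close>
  also have "\<dots> \<le> (1 - \<delta>) * (1 - 1 / (\<delta> * real n)) * real n * ?f (Suc k)"
  proof (intro mult_right_mono)
    have "(1 - \<delta>) / (\<delta> * real n) \<le> 1 / (\<delta> * real n)" using \<delta> n0 by (intro divide_right_mono) auto
    also have "\<dots> \<le> \<delta>" using \<delta>(1,3) n0 by (simp add: field_simps power2_eq_square)
    finally show "1 - 2 * \<delta> \<le> (1 - \<delta>) * (1 - 1 / (\<delta> * real n))" by (simp add: algebra_simps diff_divide_distrib)
  qed (use n0 in auto)
  finally have le: "(1 - 1 / (\<delta> * real n)) * (real n * (real n * ?f k)) \<le> (1 - 1 / (\<delta> * real n)) * (real n * ((1 - \<delta>) * ?f (Suc k)))"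
    by (simp only: power2_eq_square mult_ac)
  have fk: "real n * ?f k \<le> (1 - \<delta>) * ?f (Suc k)"
  \<comment> \<open>The common factor can be cancelled unless it is \<open>0\<close>, which would
    force \<open>\<delta> \<ge> 1\<close>.\<close>
  proof (cases "\<delta> * real n = 1")
    case True
    have "\<delta>\<^sup>2 * real n = \<delta> * (\<delta> * real n)" by (simp only: power2_eq_square mult.assoc)
    then have "\<delta> \<ge> 1" using \<delta>(3) True by simp
    then show ?thesis using \<delta>(2) by simp
  next
    case False
    then have "0 < 1 - 1 / (\<delta> * real n)" using dn by (simp add: field_simps)
    then have "real n * (real n * ?f k) \<le> real n * ((1 - \<delta>) * ?f (Suc k))"
      using le by (rule mult_left_le_imp_le[rotated])
    then show ?thesis using n0 by simp
  qed
  have "real (total_conn V (Suc k)) \<le> real (n * card (forests V (Suc k)) + n * total_conn V k)"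
    using total_conn_Suc[OF V, of k] unfolding n of_nat_le_iff .
  then have "?T (Suc k) \<le> real n * ?f (Suc k) + real n * ?T k" by simp
  then have "\<delta> * ?T (Suc k) \<le> \<delta> * (real n * ?f (Suc k) + real n * ?T k)" using \<delta>(1) by (intro mult_left_mono) auto
  also have "\<dots> = \<delta> * real n * ?f (Suc k) + real n * (\<delta> * ?T k)" by (simp add: algebra_simps)
  also have "\<dots> \<le> \<delta> * real n * ?f (Suc k) + real n * (real n * ?f k)"
    using IH n0 by (intro add_left_mono mult_left_mono) auto
  also have "\<dots> \<le> \<delta> * real n * ?f (Suc k) + real n * ((1 - \<delta>) * ?f (Suc k))"
    using fk n0 by (intro add_left_mono mult_left_mono) auto
  finally show ?case by (simp add: algebra_simps)
qed

text \<open>Product of the ratios. Up to the power of \<open>1 - 1 / (\<delta> * real n)\<close>,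
  bounded below for \<open>k \<le> n\<close> and fixed \<open>\<delta>\<close>, the count reaches
  \<open>(n^2 / 2)^k / k!\<close>, which bounds the number of all graphs with \<open>k\<close> edges
  from above.\<close>

lemma forests_subcritical:
  assumes \<delta>: "0 < \<delta>" "\<delta> < 1" "1 \<le> \<delta>\<^sup>2 * real n" and k: "2 * real k \<le> (1 - 2 * \<delta>) * real n"
  shows "((1 - 1 / (\<delta> * real n)) * (real n ^ 2 / 2)) ^ k \<le> fact k * real (card (forests V k))"
  using k
proof (induction k)
  case 0
  then show ?case using V by simp
next
  case (Suc k)
  let ?f = "\<lambda>k. real (card (forests V k))" and ?x = "1 - 1 / (\<delta> * real n)"
  have n0: "real n > 0" using \<delta> by (metis mult_zero_right not_gr_zero of_nat_0 of_nat_0_less_iff not_one_le_zero)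
  have dn: "1 \<le> \<delta> * real n"
  proof -
    have "\<delta>\<^sup>2 * real n \<le> \<delta> * real n" using \<delta> by (intro mult_right_mono) (auto simp: power2_eq_square)
    then show ?thesis using \<delta>(3) by linarith
  qed
  then have x0: "0 \<le> ?x" by (simp add: field_simps)
  have "\<delta> * real (total_conn V k) \<le> real n * ?f k"
    using Suc.prems by (intro total_conn_subcritical \<delta>) auto
  then have "real (total_conn V k) \<le> (1 - ?x) * real n ^ 2 * ?f k"
    using n0 \<delta>(1) by (simp add: field_simps power2_eq_square)
  then have r: "?x * real n ^ 2 * ?f k \<le> 2 * real (Suc k) * ?f (Suc k)" by (rule card_forests_ratio)
  have "(?x * (real n ^ 2 / 2)) ^ Suc k \<le> (?x * (real n ^ 2 / 2)) * (fact k * ?f k)"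
    using Suc x0 by (simp only: power_Suc) (intro mult_left_mono, auto)
  also have "\<dots> = fact k * (?x * real n ^ 2 * ?f k) / 2" by simp
  also have "\<dots> \<le> fact k * (2 * real (Suc k) * ?f (Suc k)) / 2" using r by (intro divide_right_mono mult_left_mono) auto
  also have "\<dots> = fact (Suc k) * ?f (Suc k)" by (simp add: algebra_simps)
  finally show ?case .
qed

text \<open>Up to \<open>3 / 5 * n\<close> edges at least \<open>2 / 5 * n\<close> components
  remain, hence at least \<open>n^2 / 10\<close> ordered pairs to join; each further edge loses at
  most a factor \<open>1 / 10\<close> against \<open>n^2 / 2\<close>. The \<open>+ 1\<close> admits
  an edge added to a forest with at most \<open>3 / 5 * n\<close> edges.\<close>

lemma forests_extend:
  assumes "7 \<le> n" "real (k + j) \<le> 3 / 5 * real n + 1"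
  shows "(real n ^ 2 / 20) ^ j * (fact k * real (card (forests V k))) \<le> fact (k + j) * real (card (forests V (k + j)))"
  using assms(2)
proof (induction j)
  case 0
  then show ?case by simp
next
  case (Suc j)
  let ?f = "\<lambda>k. real (card (forests V k))"
  have kj: "real (k + j) \<le> 3 / 5 * real n" using Suc.prems by simp
  then have kn: "k + j \<le> n" by linarith
  define D where "D = (n - (k + j)) * (n - (k + j) - 1)"
  have "total_conn V (k + j) + D * card (forests V (k + j)) \<le> n ^ 2 * card (forests V (k + j))"
    using total_conn_le[OF V, of "k + j"] kn unfolding n D_def by simp
  then have "real (total_conn V (k + j) + D * card (forests V (k + j))) \<le> real (n ^ 2 * card (forests V (k + j)))"
    unfolding of_nat_le_iff .
  then have T: "real (total_conn V (k + j)) \<le> (real n ^ 2 - real D) * ?f (k + j)"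
    by (simp add: left_diff_distrib)
  have "real n ^ 2 / 10 \<le> real D"
  proof -
    have n1: "2 / 5 * real n \<le> real (n - (k + j))" using kj kn by simp
    then have n2: "2 / 5 * real n - 1 \<le> real (n - (k + j) - 1)" by linarith
    have "real n ^ 2 / 10 \<le> (2 / 5 * real n) * (2 / 5 * real n - 1)"
    proof -
      \<comment> \<open>\<open>3 / 50\<close> is \<open>4 / 25 - 1 / 10\<close>; the bracket is
        nonnegative from \<open>n = 7\<close> on.\<close>
      have "0 \<le> real n * (real n * (3 / 50) - 2 / 5)" using assms(1) by (intro mult_nonneg_nonneg) auto
      then show ?thesis by (simp add: power2_eq_square algebra_simps)
    qed
    also have "\<dots> \<le> real (n - (k + j)) * real (n - (k + j) - 1)"
      using n1 n2 assms(1) by (intro mult_mono) auto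
    finally show ?thesis by (simp add: D_def)
  qed
  then have "(real n ^ 2 - real D) * ?f (k + j) \<le> (1 - 1 / 10) * real n ^ 2 * ?f (k + j)"
    by (intro mult_right_mono) auto
  with T have "real (total_conn V (k + j)) \<le> (1 - 1 / 10) * real n ^ 2 * ?f (k + j)" by linarith
  then have r: "1 / 10 * real n ^ 2 * ?f (k + j) \<le> 2 * real (Suc (k + j)) * ?f (Suc (k + j))" by (rule card_forests_ratio)
  have "(real n ^ 2 / 20) ^ Suc j * (fact k * ?f k) \<le> (real n ^ 2 / 20) * (fact (k + j) * ?f (k + j))"
    using Suc by (simp only: power_Suc mult.assoc) (intro mult_left_mono, auto)
  also have "\<dots> = fact (k + j) * (1 / 10 * real n ^ 2 * ?f (k + j)) / 2" by simp
  also have "\<dots> \<le> fact (k + j) * (2 * real (Suc (k + j)) * ?f (Suc (k + j))) / 2"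
    using r by (intro divide_right_mono mult_left_mono) auto
  also have "\<dots> = fact (k + Suc j) * ?f (k + Suc j)" by (simp add: algebra_simps)
  finally show ?case .
qed

lemma card_edges_on: "2 * card (edges_on V) \<le> n ^ 2"
proof -
  have "card (edges_on V) = n choose 2" unfolding edges_on_def using n_subsets[OF V] n by simp
  then show ?thesis by (simp add: choose_two power2_eq_square) (metis diff_le_self mult_le_mono2 times_div_less_eq_dividend le_trans)
qed

text \<open>The main terms cancel: \<open>(n^2 / 2)^m * p^m = m^m\<close>, Stirling gives
  \<open>m^m / m! \<ge> e^m / (e * n)\<close>, and the absent edges contribute
  \<open>e^(-m)\<close>. The losses are \<open>e^(-1) / n\<close> from Stirling,
  \<open>e^(-4)\<close> from the second-order term of \<open>1 - p\<close>,
  \<open>e^(-2 / \<delta>)\<close> from the subcritical ratios, and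
  \<open>1 / 10 \<ge> e^(-4)\<close> for each of the \<open>m - k\<close> edges beyond them.\<close>

lemma forest_weight:
  assumes \<delta>: "0 < \<delta>" "\<delta> < 1" "1 \<le> \<delta>\<^sup>2 * real n" "2 \<le> \<delta> * real n" and n7: "7 \<le> n"
    and m: "real m \<le> 3 / 5 * real n" "2 * real k \<le> (1 - 2 * \<delta>) * real n" "k \<le> m"
    and p: "p = 2 * real m / real n ^ 2"
  shows "exp (- 5 - 2 / \<delta> - 4 * real (m - k)) / real n
    \<le> real (card (forests V m)) * (p ^ m * (1 - p) ^ (card (edges_on V) - m))"
proof -
  have n0: "real n > 0" using n7 by simp
  define x where "x = 1 / (\<delta> * real n)"
  have x: "0 \<le> x" "x \<le> 1 / 2" using \<delta> n0 by (auto simp: x_def field_simps)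
  have mn: "real m \<le> real n" using m(1) by simp
  have p0: "0 \<le> p" "p \<le> 1 / 2"
  proof -
    show "0 \<le> p" by (simp add: p)
    have "4 * real m \<le> real n * real n"
    proof -
      have "4 * real m \<le> 4 * real n" using mn by simp
      also have "\<dots> \<le> real n * real n" using n7 by (intro mult_right_mono) auto
      finally show ?thesis .
    qed
    then show "p \<le> 1 / 2" using n0 by (simp add: p field_simps power2_eq_square)
  qed
  have pN: "p * real (card (edges_on V)) \<le> real m"
  proof -
    have "real (2 * card (edges_on V)) \<le> real (n ^ 2)" using card_edges_on unfolding of_nat_le_iff .
    then have "p * (2 * real (card (edges_on V))) \<le> p * real n ^ 2" using p0 by (intro mult_left_mono) auto
    also have "\<dots> = 2 * real m" using n0 by (simp add: p)
    finally show ?thesis by simp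
  qed
  have "exp (- real m - 4) \<le> (1 - p) ^ card (edges_on V)"
  proof -
    have "p * p * real (card (edges_on V)) \<le> p * real m"
      using mult_left_mono[OF pN p0(1)] by (simp add: mult.assoc)
    also have "\<dots> \<le> p * real n" using mn p0 by (intro mult_left_mono) auto
    also have "\<dots> = 2 * (real m / real n)" using n0 by (simp add: p power2_eq_square)
    also have "real m / real n \<le> 1" using mn n0 by (simp add: divide_le_eq)
    finally have pp: "p * p * real (card (edges_on V)) \<le> 2" by simp
    have "exp (- real m - 4) \<le> exp (real (card (edges_on V)) * (- p - 2 * p\<^sup>2))"
      using pN pp by (simp add: power2_eq_square algebra_simps)
    also have "\<dots> = exp (- p - 2 * p\<^sup>2) ^ card (edges_on V)" by (rule exp_of_nat_mult)
    also have "\<dots> \<le> (1 - p) ^ card (edges_on V)" using one_minus_ge_exp[OF p0] by (intro power_mono) auto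
    finally show ?thesis .
  qed
  also have "\<dots> \<le> (1 - p) ^ (card (edges_on V) - m)" using p0 by (intro power_decreasing) auto
  finally have w: "exp (- real m - 4) \<le> (1 - p) ^ (card (edges_on V) - m)" .
  have "exp (- 2 / \<delta>) \<le> (1 - x) ^ n"
  proof -
    have "2 * x\<^sup>2 \<le> x" using x mult_left_le[of "2 * x" x] by (simp add: power2_eq_square)
    then have "exp (- 2 * x) \<le> exp (- x - 2 * x\<^sup>2)" by simp
    also have "\<dots> \<le> 1 - x" by (rule one_minus_ge_exp[OF x])
    finally have "exp (- 2 * x) ^ n \<le> (1 - x) ^ n" by (intro power_mono) auto
    moreover have "exp (- 2 * x) ^ n = exp (- 2 / \<delta>)" using n0 by (simp add: exp_of_nat_mult[symmetric] x_def)
    ultimately show ?thesis by simp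
  qed
  also have "\<dots> \<le> (1 - x) ^ k" using m x by (intro power_decreasing) auto
  finally have xk: "exp (- 2 / \<delta>) \<le> (1 - x) ^ k" .
  have ten: "exp (- 4) \<le> (1 / 10 :: real)"
  proof -
    have "(2::real) \<le> exp 1" using exp_ge_add_one_self[of 1] by simp
    then have "(2::real) ^ 4 \<le> exp 1 ^ 4" by (intro power_mono) auto
    also have "exp 1 ^ 4 = exp (4::real)" by (simp add: exp_of_nat_mult[symmetric])
    finally show ?thesis by (simp add: exp_minus field_simps)
  qed
  have "(real n ^ 2 / 2) ^ m * (exp (- 2 / \<delta>) * exp (- 4 * real (m - k)))
      \<le> (real n ^ 2 / 2) ^ m * ((1 - x) ^ k * (1 / 10) ^ (m - k))"
  proof (intro mult_left_mono mult_mono xk)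
    have "exp (- 4 * real (m - k)) = exp (- 4) ^ (m - k)" by (simp add: exp_of_nat_mult[symmetric] mult.commute)
    also have "\<dots> \<le> (1 / 10) ^ (m - k)" using ten by (intro power_mono) auto
    finally show "exp (- 4 * real (m - k)) \<le> (1 / 10) ^ (m - k)" .
  qed (use x in auto)
  also have "\<dots> = (real n ^ 2 / 20) ^ (m - k) * ((1 - x) * (real n ^ 2 / 2)) ^ k"
  proof -
    have "(real n ^ 2 / 2) ^ m = (real n ^ 2 / 2) ^ (m - k) * (real n ^ 2 / 2) ^ k"
      using m(3) by (simp flip: power_add)
    moreover have "(real n ^ 2 / 20) ^ (m - k) = (real n ^ 2 / 2) ^ (m - k) * (1 / 10) ^ (m - k)"
      by (simp flip: power_mult_distrib)
    ultimately show ?thesis by (simp only: power_mult_distrib[of "1 - x"] mult_ac)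
  qed
  also have "\<dots> \<le> (real n ^ 2 / 20) ^ (m - k) * (fact k * real (card (forests V k)))"
    using forests_subcritical[OF \<delta>(1,2,3) m(2)] unfolding x_def by (intro mult_left_mono) auto
  also have "\<dots> \<le> fact (k + (m - k)) * real (card (forests V (k + (m - k))))"
    using m by (intro forests_extend n7) auto
  also have "\<dots> = fact m * real (card (forests V m))" using m(3) by simp
  finally have F: "(real n ^ 2 / 2) ^ m * (exp (- 2 / \<delta>) * exp (- 4 * real (m - k))) \<le> fact m * real (card (forests V m))" .
  have pm: "(real n ^ 2 / 2) ^ m * p ^ m = real m ^ m"
    using n0 by (simp add: p flip: power_mult_distrib)
  have "fact m * exp (real m) \<le> exp 1 * real (max m 1) * real m ^ m" by (rule fact_le_power)
  also have "\<dots> \<le> exp 1 * real n * real m ^ m"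
    using mn n7 by (intro mult_right_mono mult_left_mono) auto
  finally have st: "fact m \<le> exp 1 * real n * real m ^ m * exp (- real m)"
    by (simp add: exp_minus field_simps)
  have "fact m * (exp (- 5 - 2 / \<delta> - 4 * real (m - k)) / real n) \<le>
      (exp 1 * real n * real m ^ m * exp (- real m)) * (exp (- 5 - 2 / \<delta> - 4 * real (m - k)) / real n)"
    using n0 by (intro mult_right_mono st) auto
  also have "\<dots> = real m ^ m * (exp (- 2 / \<delta>) * exp (- 4 * real (m - k)) * exp (- real m - 4))"
    using n0 by (simp add: mult_ac flip: exp_add)
  also have "\<dots> \<le> real m ^ m * (exp (- 2 / \<delta>) * exp (- 4 * real (m - k)) * (1 - p) ^ (card (edges_on V) - m))"
    using w by (intro mult_left_mono) auto
  also have "\<dots> = ((real n ^ 2 / 2) ^ m * (exp (- 2 / \<delta>) * exp (- 4 * real (m - k)))) * (p ^ m * (1 - p) ^ (card (edges_on V) - m))"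
    unfolding pm[symmetric] by (simp add: mult_ac)
  also have "\<dots> \<le> (fact m * real (card (forests V m))) * (p ^ m * (1 - p) ^ (card (edges_on V) - m))"
    using p0 by (intro mult_right_mono F) auto
  finally have "fact m * (exp (- 5 - 2 / \<delta> - 4 * real (m - k)) / real n) \<le>
    fact m * (real (card (forests V m)) * (p ^ m * (1 - p) ^ (card (edges_on V) - m)))" by (simp add: mult.assoc)
  then show ?thesis by (rule mult_left_le_imp_le) simp
qed

end

section \<open>Forests are planar\<close>

lemma forest_leaf:
  assumes "forest E" "finite E" "E \<noteq> {}" and two: "\<forall>e\<in>E. card e = 2"
  obtains v w where "{v, w} \<in> E" "v \<noteq> w" "\<forall>e\<in>E. w \<in> e \<longrightarrow> e = {v, w}"
proof -
  \<comment> \<open>An edge \<open>{x, y}\<close> with the fewest vertices on the side of \<open>y\<close> ends in the leaf \<open>y\<close>.\<close>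
  define S where "S = (\<lambda>(x, y). {a. conn (E - {{x, y}}) y a})"
  have fin: "finite (S q)" for q
  proof -
    obtain x y where q: "q = (x, y)" by force
    have "a \<in> insert y (\<Union>E)" if "conn (E - {{x, y}}) y a" for a
      using that by (induction rule: conn_induct) auto
    moreover have "finite (\<Union>E)" 
      using assms(2) two by (metis finite_Union card.infinite zero_neq_numeral)
    ultimately have "S q \<subseteq> insert y (\<Union>E)" "finite (insert y (\<Union>E))" unfolding S_def q by auto
    then show ?thesis by (rule finite_subset)
  qed
  obtain e where "e \<in> E" using assms(3) by auto
  with two obtain x0 y0 where "{x0, y0} \<in> E" by (metis card_2_iff)
  then have "\<exists>q. (case q of (x, y) \<Rightarrow> {x, y} \<in> E) \<and> (\<forall>q'. (case q' of (x, y) \<Rightarrow> {x, y} \<in> E) \<longrightarrow> card (S q) \<le> card (S q'))"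
    by (intro ex_has_least_nat[where k = "(x0, y0)"]) auto
  then obtain x y where xy: "{x, y} \<in> E" and least: "\<And>x' y'. {x', y'} \<in> E \<Longrightarrow> card (S (x, y)) \<le> card (S (x', y'))"
    by auto
  have "x \<noteq> y" using two xy by force
  moreover have "e = {x, y}" if e: "e \<in> E" "y \<in> e" for e
  proof (rule ccontr)
    assume ne: "e \<noteq> {x, y}"
    obtain z where z: "e = {y, z}" "z \<noteq> y" using e two by (metis card_2_iff insert_commute insertE singletonD)
    have nc: "\<not> conn (E - {{y, z}}) z y"
      using assms(1) e z unfolding forest_def by (metis conn_sym)
    have sub: "conn (E - {{x, y}} - {{y, z}}) z a" if "conn (E - {{y, z}}) z a" for a
      using that
    proof (induction rule: conn_induct)
      case refl
      then show ?case by simp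
    next
      case (step a b)
      have "conn (E - {{y, z}}) z b" using step.hyps conn_edge conn_trans by metis
      then have "a \<noteq> y" "b \<noteq> y" using step.hyps nc by auto
      then have "{a, b} \<noteq> {x, y}" by (auto simp: doubleton_eq_iff)
      then have "{a, b} \<in> E - {{x, y}} - {{y, z}}" using step.hyps by auto
      then show ?case by (rule conn_trans[OF step.IH conn_edge])
    qed
    have "conn (E - {{x, y}}) y z" using e z ne by (intro conn_edge) auto
    then have "S (y, z) \<subseteq> S (x, y)"
      unfolding S_def using sub by (auto intro: conn_trans conn_mono[where E = "E - {{x, y}} - {{y, z}}"])
    moreover have "y \<in> S (x, y)" "y \<notin> S (y, z)" using nc by (auto simp: S_def)
    ultimately have "card (S (y, z)) < card (S (x, y))" using fin by (intro psubset_card_mono) auto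
    then show False using least[of y z] e z by auto
  qed
  ultimately show ?thesis using that xy by blast
qed

text \<open>A short segment at \<open>q\<close> misses the closed set \<open>Z\<close>, and a slope
  different from those towards the finitely many points of \<open>B\<close> keeps it off the
  segments to them. In the application a leaf is attached at \<open>q\<close>, and \<open>Z\<close>
  is the part of the drawing away from \<open>q\<close>.\<close>

lemma exists_new_vertex:
  fixes q :: "real^2"
  assumes "closed Z" "q \<notin> Z" "finite B"
  obtains p where "p \<noteq> q" "closed_segment q p \<inter> Z = {}"
    "\<And>b. b \<in> B \<Longrightarrow> closed_segment q b \<inter> closed_segment q p = {q}"
proof -
  obtain r where r: "r > 0" "Elementary_Metric_Spaces.ball q r \<inter> Z = {}"
    using assms(1,2) by (metis open_Compl open_contains_ball ComplI disjoint_eq_subset_Compl)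
  \<comment> \<open>Vertical directions and \<open>b = q\<close> get slope \<open>0\<close> through
    division by zero. This merely forbids one more value of \<open>k\<close>; such points cause no
    trouble, as the chosen direction has first coordinate \<open>1\<close>.\<close>
  have "finite ((\<lambda>b. (b - q) $ 2 / (b - q) $ 1) ` B)" using assms(3) by simp
  then obtain k :: real where "k \<notin> (\<lambda>b. (b - q) $ 2 / (b - q) $ 1) ` B"
    using ex_new_if_finite[OF infinite_UNIV_char_0] by blast
  then have k: "(b - q) $ 2 / (b - q) $ 1 \<noteq> k" if "b \<in> B" for b using that by blast
  define d :: "real^2" where "d = vector [1, k]"
  have d: "d $ 1 = 1" "d $ 2 = k" by (auto simp: d_def)
  have "d \<noteq> 0" using d(1) by auto
  define s where "s = r / (2 * norm d)"
  have s: "s > 0" "s * norm d < r" using r(1) \<open>d \<noteq> 0\<close> by (auto simp: s_def)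
  let ?p = "q + s *\<^sub>R d"
  have seg: "\<exists>u. 0 \<le> u \<and> u \<le> 1 \<and> x = q + (u * s) *\<^sub>R d" if "x \<in> closed_segment q ?p" for x
    using that by (auto simp: closed_segment_def algebra_simps)
  show ?thesis
  proof
    show "?p \<noteq> q" using s \<open>d \<noteq> 0\<close> by auto
    show "closed_segment q ?p \<inter> Z = {}"
    proof -
      have "x \<in> Elementary_Metric_Spaces.ball q r" if x: "x \<in> closed_segment q ?p" for x
      proof -
        obtain u where u: "0 \<le> u" "u \<le> 1" "x = q + (u * s) *\<^sub>R d" using seg[OF x] by auto
        have "dist q x = u * (s * norm d)" using u s by (simp add: dist_norm)
        also have "\<dots> \<le> 1 * (s * norm d)" using u s by (intro mult_right_mono) auto
        finally show ?thesis using s by simp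
      qed
      then show ?thesis using r(2) by blast
    qed
    show "closed_segment q b \<inter> closed_segment q ?p = {q}" if b: "b \<in> B" for b
    proof -
      have "x = q" if x: "x \<in> closed_segment q b" "x \<in> closed_segment q ?p" for x
      proof (rule ccontr)
        assume "x \<noteq> q"
        obtain u where u: "x = q + (u * s) *\<^sub>R d" using seg[OF x(2)] by auto
        obtain t where t: "x = q + t *\<^sub>R (b - q)" using x(1) by (auto simp: closed_segment_def algebra_simps)
        have "(u * s) *\<^sub>R d = t *\<^sub>R (b - q)" using u t by simp
        then have "((u * s) *\<^sub>R d) $ i = (t *\<^sub>R (b - q)) $ i" for i by simp
        then have eq: "u * s = t * (b - q) $ 1" "u * s * k = t * (b - q) $ 2"
          using d by (metis mult.right_neutral real_scaleR_def vector_scaleR_component)+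
        have us: "u * s \<noteq> 0" using u \<open>x \<noteq> q\<close> by auto
        then have "(b - q) $ 1 \<noteq> 0" "t \<noteq> 0" using eq(1) by auto
        moreover have "t * (b - q) $ 2 = t * (k * (b - q) $ 1)"
          using eq by (metis mult.assoc mult.commute)
        ultimately have "(b - q) $ 2 / (b - q) $ 1 = k" by simp
        then show False using k b by blast
      qed
      then show ?thesis by auto
    qed
  qed
qed

text \<open>Straight-line drawing by removing a leaf edge \<open>{v, w}\<close>, drawing the rest,
  and moving the now isolated \<open>w\<close> close to \<open>v\<close>; the vertex set stays fixed
  throughout. Convex hulls represent edges without a choice of orientation.\<close>

lemma forest_drawing:
  fixes V :: "'a set"
  assumes "finite V" "E \<subseteq> edges_on V" "forest E"
  shows "\<exists>f::'a \<Rightarrow> real^2. inj_on f V \<and> (\<forall>e\<in>E. convex hull (f ` e) \<inter> f ` V = f ` e) \<and>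
    (\<forall>e\<in>E. \<forall>e'\<in>E. e \<noteq> e' \<longrightarrow> convex hull (f ` e) \<inter> convex hull (f ` e') = f ` (e \<inter> e'))"
  using assms(2,3)
proof (induction "card E" arbitrary: E)
  case 0
  then have "E = {}" using finite_subset[OF _ finite_edges_on[OF assms(1)]] by auto
  obtain g :: "'a \<Rightarrow> nat" where "inj_on g V"
    using finite_imp_inj_to_nat_seg[OF assms(1)] by metis
  \<comment> \<open>Without edges any distinct points do, here on the diagonal of the plane.\<close>
  then have "inj_on (\<lambda>v. vec (real (g v)) :: real^2) V"
    by (auto simp: inj_on_def vec_eq_iff)
  then show ?case using \<open>E = {}\<close> by auto
next
  case (Suc k)
  have finE: "finite E" using Suc.prems finite_subset[OF _ finite_edges_on[OF assms(1)]] by auto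
  have EV: "e \<subseteq> V" "card e = 2" if "e \<in> E" for e using that Suc.prems by (auto simp: edges_on_def)
  have "E \<noteq> {}" using Suc.hyps(2) by auto
  then obtain v w where vw: "{v, w} \<in> E" "v \<noteq> w" "\<forall>e\<in>E. w \<in> e \<longrightarrow> e = {v, w}"
    using forest_leaf[OF Suc.prems(2) finE] EV by metis
  define F where "F = E - {{v, w}}"
  have "k = card F" using Suc.hyps(2) finE vw(1) by (simp add: F_def)
  moreover have "F \<subseteq> edges_on V" "forest F" using Suc.prems forest_subset[of E F] by (auto simp: F_def)
  ultimately obtain f :: "'a \<Rightarrow> real^2" where inj: "inj_on f V"
    and fV: "\<And>e. e \<in> F \<Longrightarrow> convex hull (f ` e) \<inter> f ` V = f ` e"
    and ff: "\<And>e e'. e \<in> F \<Longrightarrow> e' \<in> F \<Longrightarrow> e \<noteq> e' \<Longrightarrow> convex hull (f ` e) \<inter> convex hull (f ` e') = f ` (e \<inter> e')"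
    using Suc.hyps(1) by metis
  have vV: "v \<in> V" "w \<in> V" using EV(1) vw(1) by auto
  have F: "e \<in> E" "e \<subseteq> V" "w \<notin> e" "finite e" if "e \<in> F" for e
  proof -
    show e: "e \<in> E" "e \<subseteq> V" using that EV(1) by (auto simp: F_def)
    show "w \<notin> e" using that vw(3) by (auto simp: F_def)
    show "finite e" using finite_subset[OF e(2) assms(1)] .
  qed
  have finF: "finite F" using finE by (simp add: F_def)
  \<comment> \<open>What the new segment must avoid entirely, including the old position of
    \<open>w\<close>. Edges at \<open>v\<close> contain \<open>f v\<close> and so cannot be part of
    \<open>Z\<close>; they are controlled by their directions.\<close>
  define Z where "Z = f ` (V - {v}) \<union> (\<Union>e\<in>{e\<in>F. v \<notin> e}. convex hull (f ` e))"
  have "closed Z" unfolding Z_def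
  proof (intro closed_Un closed_UN ballI)
    show "closed (f ` (V - {v}))" using assms(1) by (intro finite_imp_closed) auto
    show "finite {e \<in> F. v \<notin> e}" using finF by simp
    fix e assume "e \<in> {e \<in> F. v \<notin> e}"
    then have "compact (f ` e)" using F(4)[of e] by (intro finite_imp_compact) auto
    then show "closed (convex hull (f ` e))" by (intro compact_imp_closed compact_convex_hull)
  qed
  have "f v \<notin> Z"
  proof
    assume "f v \<in> Z"
    then consider a where "a \<in> V" "a \<noteq> v" "f v = f a" | e where "e \<in> F" "v \<notin> e" "f v \<in> convex hull (f ` e)"
      unfolding Z_def by auto
    then show False
    proof cases
      case 1
      then show ?thesis using inj vV by (auto dest: inj_onD)
    next
      case 2
      then have "f v \<in> f ` e" using fV[of e] vV by auto
      then show ?thesis using 2 inj vV F(2)[of e] by (auto dest: inj_onD)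
    qed
  qed
  then obtain p where p: "p \<noteq> f v" "closed_segment (f v) p \<inter> Z = {}"
    "\<And>b. b \<in> f ` V \<Longrightarrow> closed_segment (f v) b \<inter> closed_segment (f v) p = {f v}"
    using exists_new_vertex[OF \<open>closed Z\<close>, of "f v" "f ` V"] assms(1) by auto
  define g where "g = f(w := p)"
  have gv: "g v = f v" "g w = p" using vw(2) by (auto simp: g_def)
  have ge: "g ` X = f ` X" if "w \<notin> X" for X using that by (auto simp: g_def)
  have gV: "g ` V = insert p (f ` (V - {w}))" using vV by (auto simp: g_def)
  have hull: "convex hull (g ` {v, w}) = closed_segment (f v) p" by (simp add: gv segment_convex_hull)
  have pZ: "p \<notin> Z" using p(2) by auto
  have new: "convex hull (f ` e) \<inter> closed_segment (f v) p = f ` (e \<inter> {v, w})" if e: "e \<in> F" for e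
  proof (cases "v \<in> e")
    case True
    then obtain b where b: "e = {v, b}" using EV(2)[OF F(1)[OF e]] by (auto simp: card_2_iff)
    then have "convex hull (f ` e) = closed_segment (f v) (f b)" by (simp add: segment_convex_hull)
    moreover have "f b \<in> f ` V" using b F(2)[OF e] by auto
    moreover have "e \<inter> {v, w} = {v}" using True F(3)[OF e] by auto
    ultimately show ?thesis using p(3) by auto
  next
    case False
    then have "convex hull (f ` e) \<subseteq> Z" using e by (auto simp: Z_def)
    moreover have "e \<inter> {v, w} = {}" using False F(3)[OF e] by auto
    ultimately show ?thesis using p(2) by auto
  qed
  have pnot: "p \<notin> convex hull (f ` e)" if e: "e \<in> F" for e
  proof
    assume "p \<in> convex hull (f ` e)"
    then have "p \<in> f ` (e \<inter> {v, w})" using new[OF e] by auto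
    then show False using p(1) F(3)[OF e] by auto
  qed
  have EF: "e = {v, w} \<or> e \<in> F" if "e \<in> E" for e using that by (auto simp: F_def)
  have "inj_on g V"
  proof (rule inj_onI)
    have *: "p \<noteq> f x" if "x \<in> V" "x \<noteq> w" for x
      using that p(1) pZ unfolding Z_def by auto
    fix x y assume "x \<in> V" "y \<in> V" "g x = g y"
    then show "x = y" using *[of x] *[of y] inj unfolding g_def
      by (auto split: if_splits dest: inj_onD)
  qed
  moreover have "convex hull (g ` e) \<inter> g ` V = g ` e" if e: "e \<in> E" for e
  proof (cases "e = {v, w}")
    case True
    have "closed_segment (f v) p \<inter> f ` (V - {w}) \<subseteq> {f v}" using p(2) by (auto simp: Z_def)
    then show ?thesis unfolding True hull gV using vw(2) vV by (auto simp: gv)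
  next
    case False
    then have e': "e \<in> F" using EF e by auto
    have "f ` e \<subseteq> f ` (V - {w})" using F(2,3)[OF e'] by auto
    then show ?thesis unfolding ge[OF F(3)[OF e']] gV using fV[OF e'] pnot[OF e'] by auto
  qed
  moreover have "convex hull (g ` e) \<inter> convex hull (g ` e') = g ` (e \<inter> e')"
    if e: "e \<in> E" "e' \<in> E" "e \<noteq> e'" for e e'
  proof -
    have *: "convex hull (g ` d) \<inter> convex hull (g ` {v, w}) = g ` (d \<inter> {v, w})" if d: "d \<in> F" for d
    proof -
      have "w \<notin> d \<inter> {v, w}" using F(3)[OF d] by auto
      then show ?thesis unfolding hull ge[OF F(3)[OF d]] using new[OF d] ge by metis
    qed
    consider "e \<in> F" "e' \<in> F" | "e \<in> F" "e' = {v, w}" | "e = {v, w}" "e' \<in> F" using EF e by blast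
    then show ?thesis
    proof cases
      case 1
      then show ?thesis using ff[OF 1 e(3)] F(3) ge by (metis IntD1)
    next
      case 2
      then show ?thesis using * by auto
    next
      case 3
      then show ?thesis using *[of e'] by (metis Int_commute)
    qed
  qed
  ultimately show ?case by blast
qed

lemma planar_forest:
  fixes V :: "'a set"
  assumes "finite V" "E \<subseteq> edges_on V" "forest E"
  shows "planar (V, E)"
proof -
  obtain f :: "'a \<Rightarrow> real^2" where inj: "inj_on f V"
    and fV: "\<And>e. e \<in> E \<Longrightarrow> convex hull (f ` e) \<inter> f ` V = f ` e"
    and ff: "\<And>e e'. e \<in> E \<Longrightarrow> e' \<in> E \<Longrightarrow> e \<noteq> e' \<Longrightarrow> convex hull (f ` e) \<inter> convex hull (f ` e') = f ` (e \<inter> e')"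
    using forest_drawing[OF assms] by metis
  have "\<forall>e\<in>E. \<exists>a b. e = {a, b} \<and> a \<noteq> b"
    using assms(2) by (auto simp: edges_on_def card_2_iff)
  then obtain a b where ab: "\<And>e. e \<in> E \<Longrightarrow> e = {a e, b e} \<and> a e \<noteq> b e" by metis
  define \<gamma> where "\<gamma> e = linepath (f (a e)) (f (b e))" for e
  have abV: "a e \<in> V" "b e \<in> V" if "e \<in> E" for e
    using ab[OF that] assms(2) that by (auto simp: edges_on_def)
  have fe: "f ` e = {f (a e), f (b e)}" if "e \<in> E" for e
    using ab[OF that] by (metis image_empty image_insert)
  have img: "path_image (\<gamma> e) = convex hull (f ` e)" if "e \<in> E" for e
    unfolding \<gamma>_def fe[OF that] by (simp add: segment_convex_hull)
  have "arc (\<gamma> e)" if "e \<in> E" for e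
    unfolding \<gamma>_def using ab[OF that] inj abV[OF that] by (intro arc_linepath) (auto dest: inj_onD)
  moreover have "{pathstart (\<gamma> e), pathfinish (\<gamma> e)} = f ` e" if "e \<in> E" for e
    unfolding fe[OF that] by (simp add: \<gamma>_def)
  ultimately show ?thesis
    unfolding planar_def using inj fV ff img by (intro exI[of _ f] exI[of _ \<gamma>]) auto
qed

section \<open>Plane trees and balls\<close>

definition addrs :: "otree \<Rightarrow> nat list set" where
  "addrs t = {a. addr_in a t}"

fun kids :: "otree \<Rightarrow> nat list \<Rightarrow> nat" where
  "kids (Node ts) [] = length ts"
| "kids (Node ts) (i # a) = (if i < length ts then kids (ts ! i) a else 0)"

lemma addr_in_snoc: "addr_in (a @ [i]) t \<longleftrightarrow> addr_in a t \<and> i < kids t a"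
proof (induction a arbitrary: t)
  case Nil
  then show ?case by (cases t) auto
next
  case (Cons j a)
  then show ?case by (cases t) auto
qed

lemma addr_in_Nil [simp]: "addr_in [] t"
  by (cases t) auto

lemma addrs_Node: "addrs (Node ts) = insert [] (\<Union>i<length ts. (#) i ` addrs (ts ! i))"
proof (rule set_eqI)
  fix a show "a \<in> addrs (Node ts) \<longleftrightarrow> a \<in> insert [] (\<Union>i<length ts. (#) i ` addrs (ts ! i))"
    by (cases a) (auto simp: addrs_def)
qed

lemma finite_addrs: "finite (addrs t)"
  by (induction t) (auto simp: addrs_Node)

definition height_le :: "nat \<Rightarrow> otree \<Rightarrow> bool" where
  "height_le L t \<longleftrightarrow> (\<forall>a\<in>addrs t. length a \<le> L)"

text \<open>The vertices whose neighbourhoods an exploration to depth \<open>L\<close> reveals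
  completely: a leaf of depth below \<open>L\<close> is known to be childless, while nothing is
  known about children at depth \<open>L\<close>.\<close>

definition internal :: "nat \<Rightarrow> otree \<Rightarrow> nat list set" where
  "internal L t = {a \<in> addrs t. length a < L}"

lemma finite_internal: "finite (internal L t)"
  using finite_addrs by (simp add: internal_def)

lemma ex_height_le: "\<exists>L\<ge>k. height_le L t"
proof -
  have "length a \<le> max k (Max (length ` addrs t))" if "a \<in> addrs t" for a
    using that finite_addrs by (auto simp: le_max_iff_disj)
  then show ?thesis unfolding height_le_def by (metis max.cobounded1)
qed

lemma height_le_Node: "height_le (Suc L) (Node ts) \<longleftrightarrow> (\<forall>i<length ts. height_le L (ts ! i))"
  unfolding height_le_def addrs_Node by auto

lemma internal_Node: "internal (Suc L) (Node ts) = insert [] (\<Union>i<length ts. (#) i ` internal L (ts ! i))"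
  unfolding internal_def addrs_Node by auto

lemma otree_eqI:
  assumes "\<And>a. addr_in a t \<longleftrightarrow> addr_in a t'"
  shows "t = t'"
  using assms
proof (induction t arbitrary: t')
  case (Node ts)
  obtain us where t': "t' = Node us" by (cases t')
  have "i < length ts \<longleftrightarrow> i < length us" for i using Node.prems[of "[i]"] by (simp add: t')
  then have len: "length ts = length us" by (metis linorder_less_linear less_irrefl)
  have "ts ! i = us ! i" if "i < length ts" for i
  proof (rule Node.IH)
    show "ts ! i \<in> set ts" using that by simp
    show "addr_in a (ts ! i) \<longleftrightarrow> addr_in a (us ! i)" for a
      using Node.prems[of "i # a"] that len by (simp add: t')
  qed
  then show ?case using len t' by (auto intro: nth_equalityI)
qed

text \<open>
  Edges between two vertices at depth \<open>L\<close> are left unconstrained, so that adding an edge affects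
  explorations from boundedly many roots only. The price is that an exploration to depth \<open>L\<close>
  determines balls of radius less than \<open>L\<close>.
\<close>
definition explored :: "nat \<Rightarrow> otree \<Rightarrow> 'b set set \<Rightarrow> (nat list \<Rightarrow> 'b) \<Rightarrow> bool" where
  "explored L t E \<phi> \<longleftrightarrow> inj_on \<phi> (addrs t) \<and>
     {e \<in> E. e \<inter> \<phi> ` internal L t \<noteq> {}} = (\<lambda>e. \<phi> ` e) ` snd (tree_graph t)"

lemma tree_graph_edge:
  "{a, b} \<in> snd (tree_graph t) \<longleftrightarrow>
     (\<exists>i. b = a @ [i] \<and> b \<in> addrs t) \<or> (\<exists>i. a = b @ [i] \<and> a \<in> addrs t)"
  unfolding tree_graph_def addrs_def by (auto simp: doubleton_eq_iff)

lemma addrs_snocD: "a @ [i] \<in> addrs t \<Longrightarrow> a \<in> addrs t"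
  by (simp add: addrs_def addr_in_snoc)

lemma tree_graph_edge_subset: "e \<in> snd (tree_graph t) \<Longrightarrow> e \<subseteq> addrs t"
  unfolding tree_graph_def by (auto simp: addrs_def addr_in_snoc)

lemma explored_tree_graph:
  assumes "height_le L t"
  shows "explored L t (snd (tree_graph t)) (\<lambda>a. a)"
proof -
  have "e \<inter> internal L t \<noteq> {}" if e: "e \<in> snd (tree_graph t)" for e
  proof -
    obtain a i where ai: "e = {a, a @ [i]}" "a @ [i] \<in> addrs t"
      using e by (auto simp: tree_graph_def addrs_def)
    then have "a \<in> internal L t"
      using assms addrs_snocD[OF ai(2)] unfolding height_le_def internal_def by force
    then show ?thesis using ai by auto
  qed
  then show ?thesis unfolding explored_def by auto
qed

lemma explored_edge:
  assumes "explored L t E \<phi>" "height_le L t" "a \<in> internal L t"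
  shows "{\<phi> a, y} \<in> E \<longleftrightarrow> (\<exists>b\<in>addrs t. {a, b} \<in> snd (tree_graph t) \<and> y = \<phi> b)"
proof
  have inj: "inj_on \<phi> (addrs t)" and
    eq: "{e \<in> E. e \<inter> \<phi> ` internal L t \<noteq> {}} = (\<lambda>e. \<phi> ` e) ` snd (tree_graph t)"
    using assms(1) by (auto simp: explored_def)
  have a: "a \<in> addrs t" using assms(3) by (simp add: internal_def)
  {
    assume "{\<phi> a, y} \<in> E"
    then have "{\<phi> a, y} \<in> (\<lambda>e. \<phi> ` e) ` snd (tree_graph t)"
      using assms(3) eq by blast
    then obtain e where e: "e \<in> snd (tree_graph t)" "{\<phi> a, y} = \<phi> ` e" by auto
    obtain b c where bc: "e = {b, c}" using e(1) by (auto simp: tree_graph_def)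
    have "b \<in> addrs t" "c \<in> addrs t" using tree_graph_edge_subset[OF e(1)] bc by auto
    moreover have "\<phi> a = \<phi> b \<and> y = \<phi> c \<or> \<phi> a = \<phi> c \<and> y = \<phi> b"
      using e(2) bc by (auto simp: doubleton_eq_iff)
    ultimately show "\<exists>b\<in>addrs t. {a, b} \<in> snd (tree_graph t) \<and> y = \<phi> b"
      using e(1) bc a inj by (metis inj_onD insert_commute)
  }
  {
    assume "\<exists>b\<in>addrs t. {a, b} \<in> snd (tree_graph t) \<and> y = \<phi> b"
    then obtain b where b: "{a, b} \<in> snd (tree_graph t)" "y = \<phi> b" by auto
    then have "\<phi> ` {a, b} \<in> {e \<in> E. e \<inter> \<phi> ` internal L t \<noteq> {}}"
      unfolding eq by blast
    then show "{\<phi> a, y} \<in> E" using b(2) by simp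
  }
qed

text \<open>A labelled graph does not order the neighbours of a vertex. Increasing labels select one
  plane order, so that a root carries at most one tree and one labelling; in the count they turn
  sequences of children into subsets, the source of \<open>1 / k!\<close> in the Poisson
  weights.\<close>

definition siblings_mono :: "otree \<Rightarrow> (nat list \<Rightarrow> 'b::linorder) \<Rightarrow> bool" where
  "siblings_mono t \<phi> \<longleftrightarrow> (\<forall>a i j. i < j \<longrightarrow> a @ [j] \<in> addrs t \<longrightarrow> \<phi> (a @ [i]) < \<phi> (a @ [j]))"

lemma explored_children:
  assumes "explored L t E \<phi>" "height_le L t" "a \<in> internal L t"
  shows "(\<lambda>i. \<phi> (a @ [i])) ` {..<kids t a} =
    {y. {\<phi> a, y} \<in> E} - (if a = [] then {} else {\<phi> (butlast a)})" (is "?L = ?R")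
proof (rule set_eqI, rule iffI)
  have inj: "inj_on \<phi> (addrs t)" using assms(1) by (auto simp: explored_def)
  have a: "a \<in> addrs t" using assms(3) by (simp add: internal_def)
  fix y
  {
    assume "y \<in> ?L"
    then obtain i where i: "i < kids t a" "y = \<phi> (a @ [i])" by auto
    then have m: "a @ [i] \<in> addrs t" using a by (auto simp: addrs_def addr_in_snoc)
    then have "{\<phi> a, y} \<in> E"
      using explored_edge[OF assms] i(2) tree_graph_edge[of a "a @ [i]" t] by blast
    moreover have "y \<noteq> \<phi> (butlast a)" if "a \<noteq> []"
    proof
      assume "y = \<phi> (butlast a)"
      moreover have "butlast a \<in> addrs t"
        using a that by (metis addrs_snocD append_butlast_last_id)
      ultimately have "a @ [i] = butlast a" using inj i(2) m by (metis inj_onD)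
      then have "length (a @ [i]) = length (butlast a)" by (rule arg_cong)
      then show False by simp
    qed
    ultimately show "y \<in> ?R" by auto
  }
  {
    assume y: "y \<in> ?R"
    then obtain b where b: "b \<in> addrs t" "{a, b} \<in> snd (tree_graph t)" "y = \<phi> b"
      using explored_edge[OF assms] by auto
    then consider i where "b = a @ [i]" "b \<in> addrs t" | i where "a = b @ [i]"
      by (auto simp: tree_graph_edge)
    then show "y \<in> ?L"
    proof cases
      case 1
      then show ?thesis using b(3) by (auto simp: addrs_def addr_in_snoc)
    next
      case 2
      then show ?thesis using y b(3) by auto
    qed
  }
qed

text \<open>Induction on depth: the child labels of \<open>b\<close> are the neighbours of
  \<open>\<phi> b\<close> except its parent, a set that depends only on \<open>E\<close> and labels
  already matched; increasing order then determines the list.\<close>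

lemma explored_unique:
  fixes \<phi> \<phi>' :: "nat list \<Rightarrow> 'b::linorder"
  assumes t: "explored L t E \<phi>" "height_le L t" "siblings_mono t \<phi>"
    and t': "explored L t' E \<phi>'" "height_le L t'" "siblings_mono t' \<phi>'"
    and root: "\<phi> [] = \<phi>' []"
  shows "t = t'" "\<And>a. a \<in> addrs t \<Longrightarrow> \<phi> a = \<phi>' a"
proof -
  have main: "(addr_in a t \<longleftrightarrow> addr_in a t') \<and> (addr_in a t \<longrightarrow> \<phi> a = \<phi>' a)" for a
  proof (induction "length a" arbitrary: a rule: less_induct)
    case less
    show ?case
    proof (cases a rule: rev_exhaust)
      case Nil
      then show ?thesis using root by simp
    next
      case (snoc b i)
      have IHb: "(addr_in b t \<longleftrightarrow> addr_in b t')" "addr_in b t \<Longrightarrow> \<phi> b = \<phi>' b"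
        using less[of b] snoc by auto
      show ?thesis
      proof (cases "addr_in b t")
        case False
        then show ?thesis using IHb snoc by (auto simp: addr_in_snoc)
      next
        case True
        show ?thesis
        proof (cases "length b < L")
          case False
          \<comment> \<open>From depth \<open>L\<close> on the edges give no information; the height
            bound rules out children in both trees.\<close>
          then have "\<not> addr_in a t" "\<not> addr_in a t'"
            using t(2) t'(2) snoc unfolding height_le_def addrs_def by force+
          then show ?thesis by simp
        next
          case L: True
          have inn: "b \<in> internal L t" "b \<in> internal L t'"
            using L True IHb by (auto simp: internal_def addrs_def)
          have par: "\<phi> (butlast b) = \<phi>' (butlast b)" if "b \<noteq> []"
          proof -
            have "addr_in (butlast b) t"
              using True that by (metis addr_in_snoc append_butlast_last_id)
            then show ?thesis using less[of "butlast b"] snoc by simp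
          qed
          let ?xs = "map (\<lambda>i. \<phi> (b @ [i])) [0..<kids t b]"
          let ?ys = "map (\<lambda>i. \<phi>' (b @ [i])) [0..<kids t' b]"
          have "set ?xs = set ?ys"
            using explored_children[OF t(1,2) inn(1)] explored_children[OF t'(1,2) inn(2)] par IHb(2)[OF True]
            by (auto simp: atLeast0LessThan)
          moreover have "sorted_wrt (<) ?xs" "sorted_wrt (<) ?ys"
            using t(3) t'(3) True IHb unfolding sorted_wrt_iff_nth_less siblings_mono_def
            by (auto simp: addrs_def addr_in_snoc)
          ultimately have eq: "?xs = ?ys" by (metis strict_sorted_equal)
          then have k: "kids t b = kids t' b" by (metis length_map length_upt diff_zero)
          have "\<phi> (b @ [i]) = \<phi>' (b @ [i])" if "i < kids t b"
            using arg_cong[OF eq, of "\<lambda>xs. xs ! i"] that k by simp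
          then show ?thesis using snoc k IHb True by (auto simp: addr_in_snoc)
        qed
      qed
    qed
  qed
  show "t = t'" using main by (intro otree_eqI) auto
  show "\<And>a. a \<in> addrs t \<Longrightarrow> \<phi> a = \<phi>' a" using main by (auto simp: addrs_def)
qed

section \<open>Balls around an explored root\<close>

lemma within_dist_0: "within_dist G r 0 v \<longleftrightarrow> v = r \<and> r \<in> fst G"
proof
  assume "within_dist G r 0 v"
  then obtain p where "p \<noteq> []" "length p \<le> 1" "hd p = r" "last p = v" "set p \<subseteq> fst G"
    unfolding within_dist_def by auto
  then show "v = r \<and> r \<in> fst G" by (cases p) auto
next
  assume "v = r \<and> r \<in> fst G"
  then show "within_dist G r 0 v"
    unfolding within_dist_def by (intro exI[of _ "[r]"]) auto
qed

lemma within_dist_Suc: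
  "within_dist G r (Suc l) v \<longleftrightarrow>
     v = r \<and> r \<in> fst G \<or> (\<exists>u. within_dist G r l u \<and> {u, v} \<in> snd G \<and> v \<in> fst G)" (is "?L \<longleftrightarrow> ?R")
proof
  assume ?L
  then obtain p where p: "p \<noteq> []" "length p \<le> Suc (Suc l)" "hd p = r" "last p = v" "set p \<subseteq> fst G"
    "\<And>i. Suc i < length p \<Longrightarrow> {p ! i, p ! Suc i} \<in> snd G"
    unfolding within_dist_def by blast
  obtain q where q: "p = q @ [v]" using p(1,4) by (metis append_butlast_last_id)
  show ?R
  proof (cases "q = []")
    case True
    then show ?thesis using p q by auto
  next
    case False
    have "{q ! i, q ! Suc i} \<in> snd G" if "Suc i < length q" for i
      using p(6)[of i] that by (simp add: q nth_append)
    then have "within_dist G r l (last q)"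
      unfolding within_dist_def using p q False by (intro exI[of _ q]) auto
    moreover have "{last q, v} \<in> snd G"
      using p(6)[of "length q - 1"] False by (simp add: q nth_append last_conv_nth)
    moreover have "v \<in> fst G" using p(5) q by auto
    ultimately show ?thesis by blast
  qed
next
  assume ?R
  then consider "v = r" "r \<in> fst G" | u where "within_dist G r l u" "{u, v} \<in> snd G" "v \<in> fst G"
    by blast
  then show ?L
  proof cases
    case 1
    then show ?thesis unfolding within_dist_def by (intro exI[of _ "[r]"]) auto
  next
    case 2
    then obtain p where p: "p \<noteq> []" "length p \<le> Suc l" "hd p = r" "last p = u" "set p \<subseteq> fst G"
      "\<And>i. Suc i < length p \<Longrightarrow> {p ! i, p ! Suc i} \<in> snd G"
      unfolding within_dist_def by blast
    have "{(p @ [v]) ! i, (p @ [v]) ! Suc i} \<in> snd G" if i: "Suc i < length (p @ [v])" for i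
    proof (cases "Suc i < length p")
      case True
      then show ?thesis using p(6) by (simp add: nth_append)
    next
      case False
      then have "i = length p - 1" using i p(1) by auto
      then show ?thesis using p(1,4) 2(2) by (simp add: nth_append last_conv_nth)
    qed
    then show ?thesis
      unfolding within_dist_def using p 2 by (intro exI[of _ "p @ [v]"]) auto
  qed
qed

text \<open>Both sides grow by the same rule: vertices of depth below \<open>L\<close> are internal,
  so their neighbours in the graph are the images of their neighbours in the tree.\<close>

lemma explored_within_dist:
  assumes "explored L t E \<phi>" "height_le L t" "\<phi> ` addrs t \<subseteq> V" "l \<le> L"
  shows "within_dist (V, E) (\<phi> []) l v \<longleftrightarrow> v \<in> \<phi> ` {a \<in> addrs t. length a \<le> l}"
  using assms(4)
proof (induction l arbitrary: v)
  case 0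
  have "{a \<in> addrs t. length a \<le> 0} = {[]}" by (auto simp: addrs_def)
  moreover have "\<phi> [] \<in> V" using assms(3) by (auto simp: addrs_def)
  ultimately show ?case by (auto simp: within_dist_0)
next
  case (Suc l)
  have IH: "within_dist (V, E) (\<phi> []) l u \<longleftrightarrow> u \<in> \<phi> ` {a \<in> addrs t. length a \<le> l}" for u
    using Suc by simp
  have inn: "a \<in> internal L t" if "a \<in> addrs t" "length a \<le> l" for a
    using that Suc.prems by (simp add: internal_def)
  show ?case
  proof
    assume "within_dist (V, E) (\<phi> []) (Suc l) v"
    then consider "v = \<phi> []" | a where "a \<in> addrs t" "length a \<le> l" "{\<phi> a, v} \<in> E"
      unfolding within_dist_Suc IH by auto
    then show "v \<in> \<phi> ` {a \<in> addrs t. length a \<le> Suc l}"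
    proof cases
      case 1
      then show ?thesis by (auto simp: addrs_def)
    next
      case 2
      then obtain b where "b \<in> addrs t" "{a, b} \<in> snd (tree_graph t)" "v = \<phi> b"
        using explored_edge[OF assms(1,2) inn] by blast
      then show ?thesis using 2(2) by (auto simp: tree_graph_edge)
    qed
  next
    assume "v \<in> \<phi> ` {a \<in> addrs t. length a \<le> Suc l}"
    then obtain a where a: "a \<in> addrs t" "length a \<le> Suc l" "v = \<phi> a" by auto
    show "within_dist (V, E) (\<phi> []) (Suc l) v"
    proof (cases a rule: rev_exhaust)
      case Nil
      then show ?thesis using a assms(3) by (auto simp: within_dist_Suc)
    next
      case (snoc b i)
      then have b: "b \<in> addrs t" "length b \<le> l" using a addrs_snocD by auto
      then have "{\<phi> b, v} \<in> E"
        using explored_edge[OF assms(1,2) inn[OF b]] a snoc tree_graph_edge[of b a t] by blast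
      moreover have "within_dist (V, E) (\<phi> []) l (\<phi> b)" using IH b by auto
      moreover have "v \<in> V" using a assms(3) by auto
      ultimately show ?thesis unfolding within_dist_Suc by auto
    qed
  qed
qed

lemma explored_ball:
  assumes "explored L t E \<phi>" "height_le L t" "\<phi> ` addrs t \<subseteq> V" "l \<le> L"
  shows "ball (V, E) (\<phi> []) l =
    (\<phi> ` {a \<in> addrs t. length a \<le> l}, {e \<in> E. e \<subseteq> \<phi> ` {a \<in> addrs t. length a \<le> l}})"
proof -
  have "{v \<in> V. within_dist (V, E) (\<phi> []) l v} = \<phi> ` {a \<in> addrs t. length a \<le> l}"
    using explored_within_dist[OF assms] assms(3) by auto
  then show ?thesis by (simp add: ball_def Let_def)
qed

text \<open>A tree is its own exploration under the identity labelling once \<open>L\<close> is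
  large, so the formula for balls in graphs specialises to it.\<close>

lemma tree_graph_ball:
  "ball (tree_graph t) [] l = ({a \<in> addrs t. length a \<le> l},
     {e \<in> snd (tree_graph t). e \<subseteq> {a \<in> addrs t. length a \<le> l}})"
proof -
  obtain L where L: "l \<le> L" "height_le L t" using ex_height_le by blast
  have "tree_graph t = (addrs t, snd (tree_graph t))" by (simp add: tree_graph_def addrs_def)
  then show ?thesis
    using explored_ball[OF explored_tree_graph[OF L(2)] L(2) _ L(1), of "addrs t"] by simp
qed

lemma explored_rooted_iso:
  assumes "explored L t E \<phi>" "height_le L t" "\<phi> ` addrs t \<subseteq> V" "l < L"
  shows "rooted_iso (ball (tree_graph t) [] l) [] (ball (V, E) (\<phi> []) l) (\<phi> [])"
proof -
  let ?W = "{a \<in> addrs t. length a \<le> l}"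
  have inj: "inj_on \<phi> (addrs t)" using assms(1) by (simp add: explored_def)
  have e: "{x, y} \<in> snd (tree_graph t) \<longleftrightarrow> {\<phi> x, \<phi> y} \<in> E" if xy: "x \<in> ?W" "y \<in> ?W" for x y
  proof -
    \<comment> \<open>Since \<open>l < L\<close> is strict, the outermost vertices of the ball are
      internal too; edges between two of them would otherwise be unconstrained.\<close>
    have "x \<in> internal L t" using xy assms(4) by (simp add: internal_def)
    then have "{\<phi> x, \<phi> y} \<in> E \<longleftrightarrow> (\<exists>b\<in>addrs t. {x, b} \<in> snd (tree_graph t) \<and> \<phi> y = \<phi> b)"
      by (rule explored_edge[OF assms(1,2)])
    then show ?thesis using inj xy by (auto dest: inj_onD)
  qed
  show ?thesis
    unfolding rooted_iso_def tree_graph_ball explored_ball[OF assms(1,2,3) less_imp_le[OF assms(4)]]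
    using e inj by (intro exI[of _ \<phi>]) (auto intro: inj_on_subset inj_on_imp_bij_betw)
qed

lemma rooted_iso_sym: "rooted_iso G r H s \<Longrightarrow> r \<in> fst G \<Longrightarrow> rooted_iso H s G r"
proof -
  assume "rooted_iso G r H s" and r: "r \<in> fst G"
  then obtain f where f: "bij_betw f (fst G) (fst H)" "f r = s"
    "\<And>x y. x \<in> fst G \<Longrightarrow> y \<in> fst G \<Longrightarrow> {x, y} \<in> snd G \<longleftrightarrow> {f x, f y} \<in> snd H"
    unfolding rooted_iso_def by blast
  let ?g = "the_inv_into (fst G) f"
  have inj: "inj_on f (fst G)" using f(1) by (rule bij_betw_imp_inj_on)
  have g: "bij_betw ?g (fst H) (fst G)" using f(1) by (rule bij_betw_the_inv_into)
  have "{x, y} \<in> snd H \<longleftrightarrow> {?g x, ?g y} \<in> snd G" if "x \<in> fst H" "y \<in> fst H" for x y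
    using f(3)[of "?g x" "?g y"] that g f(1) by (auto simp: bij_betw_apply f_the_inv_into_f_bij_betw)
  moreover have "?g s = r" using f(2) inj r by (auto simp: the_inv_into_f_f)
  ultimately show "rooted_iso H s G r" unfolding rooted_iso_def using g by blast
qed

lemma rooted_iso_trans:
  assumes "rooted_iso G r H s" "rooted_iso H s K q"
  shows "rooted_iso G r K q"
proof -
  obtain f where f: "bij_betw f (fst G) (fst H)" "f r = s"
    "\<And>x y. x \<in> fst G \<Longrightarrow> y \<in> fst G \<Longrightarrow> {x, y} \<in> snd G \<longleftrightarrow> {f x, f y} \<in> snd H"
    using assms(1) unfolding rooted_iso_def by blast
  obtain g where g: "bij_betw g (fst H) (fst K)" "g s = q"
    "\<And>x y. x \<in> fst H \<Longrightarrow> y \<in> fst H \<Longrightarrow> {x, y} \<in> snd H \<longleftrightarrow> {g x, g y} \<in> snd K"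
    using assms(2) unfolding rooted_iso_def by blast
  have "bij_betw (g \<circ> f) (fst G) (fst K)" using f(1) g(1) by (rule bij_betw_trans)
  moreover have "{x, y} \<in> snd G \<longleftrightarrow> {(g \<circ> f) x, (g \<circ> f) y} \<in> snd K" if "x \<in> fst G" "y \<in> fst G" for x y
    using f(3)[OF that] g(3)[of "f x" "f y"] that f(1) by (auto simp: bij_betw_apply)
  ultimately show ?thesis unfolding rooted_iso_def using f(2) g(2)
    by (intro exI[of _ "g \<circ> f"]) auto
qed

lemma explored_ball_iso_iff:
  assumes "explored L t E \<phi>" "height_le L t" "\<phi> ` addrs t \<subseteq> V" "l < L"
  shows "rooted_iso (ball (V, E) (\<phi> []) l) (\<phi> []) H s \<longleftrightarrow> rooted_iso (ball (tree_graph t) [] l) [] H s"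
proof -
  have 1: "rooted_iso (ball (tree_graph t) [] l) [] (ball (V, E) (\<phi> []) l) (\<phi> [])"
    by (rule explored_rooted_iso[OF assms])
  then have 2: "rooted_iso (ball (V, E) (\<phi> []) l) (\<phi> []) (ball (tree_graph t) [] l) []"
    by (rule rooted_iso_sym) (auto simp: tree_graph_ball addrs_def)
  show ?thesis using rooted_iso_trans 1 2 by metis
qed

section \<open>Truncation and the law of the Galton--Watson tree\<close>

fun trunc :: "nat \<Rightarrow> otree \<Rightarrow> otree" where
  "trunc 0 t = Node []"
| "trunc (Suc l) (Node ts) = Node (map (trunc l) ts)"

lemma addr_in_trunc: "addr_in a (trunc l t) \<longleftrightarrow> addr_in a t \<and> length a \<le> l"
proof (induction l t arbitrary: a rule: trunc.induct)
  case (1 t)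
  then show ?case by (cases a) auto
next
  case (2 l ts)
  then show ?case by (cases a) auto
qed

lemma tree_graph_ball_trunc: "ball (tree_graph (trunc l t)) [] l = ball (tree_graph t) [] l"
proof -
  have "{a \<in> addrs (trunc l t). length a \<le> l} = {a \<in> addrs t. length a \<le> l}"
    by (auto simp: addrs_def addr_in_trunc)
  moreover have "{e \<in> snd (tree_graph (trunc l t)). e \<subseteq> {a \<in> addrs t. length a \<le> l}} =
    {e \<in> snd (tree_graph t). e \<subseteq> {a \<in> addrs t. length a \<le> l}}"
    unfolding tree_graph_def by (auto simp: addr_in_trunc addrs_def, blast)
  ultimately show ?thesis unfolding tree_graph_ball by simp
qed

lemma map_pmf_map_replicate: "map_pmf (map f) (replicate_pmf n p) = replicate_pmf n (map_pmf f p)"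
  by (induction n) (auto simp: map_bind_pmf bind_map_pmf map_pmf_def[symmetric] simp flip: map_pmf_comp
      intro!: bind_pmf_cong simp: map_pmf_comp)

lemma gw_tree_Suc: "gw_tree c (Suc l) = bind_pmf (poisson_offspring c) (\<lambda>k. map_pmf Node (replicate_pmf k (gw_tree c l)))"
  by (simp add: map_pmf_def)

lemma map_trunc_gw_tree: "map_pmf (trunc l) (gw_tree c (Suc l)) = gw_tree c l"
proof (induction l)
  case 0
  have "trunc 0 = (\<lambda>_. Node [])" by auto
  then show ?case by (simp add: map_pmf_const)
next
  case (Suc l)
  have "map_pmf (trunc (Suc l)) (gw_tree c (Suc (Suc l))) =
    bind_pmf (poisson_offspring c) (\<lambda>k. map_pmf (trunc (Suc l)) (map_pmf Node (replicate_pmf k (gw_tree c (Suc l)))))"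
    unfolding gw_tree_Suc[of c "Suc l"] map_bind_pmf ..
  also have "\<dots> = bind_pmf (poisson_offspring c) (\<lambda>k. map_pmf Node (map_pmf (map (trunc l)) (replicate_pmf k (gw_tree c (Suc l)))))"
    by (simp only: pmf.map_comp o_def trunc.simps)
  also have "\<dots> = gw_tree c (Suc l)"
    by (simp only: map_pmf_map_replicate Suc.IH gw_tree_Suc[symmetric])
  finally show ?case .
qed

text \<open>\<open>gw_ball_prob\<close> draws \<open>l\<close> generations, whereas balls of radius
  \<open>l\<close> are read off explorations to depth \<open>Suc l\<close>. One more generation
  changes neither the ball nor the law of the earlier ones.\<close>

lemma gw_ball_prob_eq:
  "gw_ball_prob c l H s =
     measure_pmf.prob (gw_tree c (Suc l)) {t. rooted_iso (ball (tree_graph t) [] l) [] H s}"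
  unfolding gw_ball_prob_def
  by (subst map_trunc_gw_tree[symmetric]) (simp only: measure_map_pmf vimage_def mem_Collect_eq tree_graph_ball_trunc)

lemma pmf_replicate: "pmf (replicate_pmf n p) xs = (if length xs = n then \<Prod>x\<leftarrow>xs. pmf p x else 0)"
proof (induction n arbitrary: xs)
  case 0
  then show ?case by (simp add: indicator_def)
next
  case (Suc n)
  have eq: "replicate_pmf (Suc n) p = map_pmf (\<lambda>(x, xs). x # xs) (pair_pmf p (replicate_pmf n p))"
    by (simp add: pair_pmf_def map_bind_pmf)
  show ?case
  proof (cases xs)
    case Nil
    then have "xs \<notin> set_pmf (replicate_pmf (Suc n) p)" by (auto simp: set_replicate_pmf simp del: replicate_pmf.simps)
    then show ?thesis using Nil by (simp add: set_pmf_iff del: replicate_pmf.simps)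
  next
    case (Cons y ys)
    have "pmf (replicate_pmf (Suc n) p) ((\<lambda>(x, xs). x # xs) (y, ys)) = pmf (pair_pmf p (replicate_pmf n p)) (y, ys)"
      unfolding eq by (intro pmf_map_inj') (auto simp: inj_def)
    then show ?thesis using Cons Suc by (simp add: pmf_pair del: replicate_pmf.simps)
  qed
qed

text \<open>Offspring numbers are drawn exactly at the vertices of depth below \<open>L\<close>. The
  expected number of occurrences in the random graph has the same shape, one factor per internal
  vertex.\<close>

lemma pmf_gw_tree:
  "pmf (gw_tree c L) t =
     (if height_le L t then \<Prod>a\<in>internal L t. pmf (poisson_offspring c) (kids t a) else 0)"
proof (induction L arbitrary: t)
  case 0
  obtain ts where t: "t = Node ts" by (cases t)
  have "height_le 0 t \<longleftrightarrow> ts = []"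
  proof -
    have "[0] \<in> addrs t" if "ts \<noteq> []" using that by (simp add: t addrs_def)
    then show ?thesis unfolding height_le_def by (force simp: t addrs_Node)
  qed
  moreover have "internal 0 t = {}" by (auto simp: internal_def)
  ultimately show ?case by (auto simp: t indicator_def)
next
  case (Suc L)
  obtain ts where t: "t = Node ts" by (cases t)
  let ?p = "gw_tree c L" and ?q = "poisson_offspring c"
  have "pmf (gw_tree c (Suc L)) t = (\<integral>k. pmf (map_pmf Node (replicate_pmf k ?p)) (Node ts) \<partial>?q)"
    unfolding gw_tree_Suc t by (rule pmf_bind)
  also have "\<dots> = (\<integral>k. pmf (replicate_pmf k ?p) ts \<partial>?q)"
    by (subst pmf_map_inj') (auto simp: inj_def)
  \<comment> \<open>A list of length \<open>k\<close> arises only from \<open>k\<close> offspring,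
    so a single term survives.\<close>
  also have "\<dots> = (\<Sum>k\<in>{length ts}. pmf (replicate_pmf k ?p) ts * pmf ?q k)"
    by (rule integral_measure_pmf_real) (auto simp: pmf_replicate split: if_splits)
  also have "\<dots> = (\<Prod>x\<leftarrow>ts. pmf ?p x) * pmf ?q (length ts)" by (simp add: pmf_replicate)
  also have "(\<Prod>x\<leftarrow>ts. pmf ?p x) = (\<Prod>i<length ts. pmf ?p (ts ! i))"
    by (simp add: prod.list_conv_set_nth atLeast0LessThan)
  finally have *: "pmf (gw_tree c (Suc L)) t = (\<Prod>i<length ts. pmf ?p (ts ! i)) * pmf ?q (length ts)" .
  show ?case
  proof (cases "height_le (Suc L) t")
    case False
    then obtain i where "i < length ts" "\<not> height_le L (ts ! i)" unfolding t height_le_Node by auto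
    then have "(\<Prod>i<length ts. pmf ?p (ts ! i)) = 0" using Suc.IH by (intro prod_zero) auto
    then show ?thesis using False * by simp
  next
    case True
    have "(\<Prod>a\<in>internal (Suc L) t. pmf ?q (kids t a)) =
      pmf ?q (length ts) * (\<Prod>a\<in>(\<Union>i<length ts. (#) i ` internal L (ts ! i)). pmf ?q (kids t a))"
      unfolding t internal_Node using finite_internal by (subst prod.insert) auto
    also have "(\<Prod>a\<in>(\<Union>i<length ts. (#) i ` internal L (ts ! i)). pmf ?q (kids t a)) =
      (\<Prod>i<length ts. \<Prod>a\<in>(#) i ` internal L (ts ! i). pmf ?q (kids t a))"
      using finite_internal by (intro prod.UNION_disjoint) auto
    also have "\<dots> = (\<Prod>i<length ts. \<Prod>a\<in>internal L (ts ! i). pmf ?q (kids (ts ! i) a))"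
      by (rule prod.cong) (auto simp: t prod.reindex)
    also have "\<dots> = (\<Prod>i<length ts. pmf ?p (ts ! i))"
      using True Suc.IH unfolding t height_le_Node by (intro prod.cong) auto
    finally show ?thesis using * True by simp
  qed
qed

section \<open>Concentration under independent edges\<close>

text \<open>Probability of \<open>E\<close> when the elements of \<open>U\<close> are included
  independently with probability \<open>p\<close>, kept as a plain weight so that means are finite
  sums over \<open>Pow U\<close>.\<close>

definition wt :: "real \<Rightarrow> 'a set \<Rightarrow> 'a set \<Rightarrow> real" where
  "wt p U E = p ^ card E * (1 - p) ^ (card U - card E)"

lemma wt_nonneg: "0 \<le> p \<Longrightarrow> p \<le> 1 \<Longrightarrow> 0 \<le> wt p U E"
  by (simp add: wt_def)

lemma sum_wt_insert:
  assumes "finite U" "u \<notin> U"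
  shows "(\<Sum>E\<in>Pow (insert u U). wt p (insert u U) E * f E) =
    (\<Sum>E\<in>Pow U. wt p U E * ((1 - p) * f E + p * f (insert u E)))"
proof -
  have inj: "inj_on (insert u) (Pow U)" using assms(2) by (intro inj_onI) (metis PowD insert_ident subsetD)
  have w: "wt p (insert u U) E = (1 - p) * wt p U E" "wt p (insert u U) (insert u E) = p * wt p U E"
    if "E \<subseteq> U" for E
  proof -
    have "finite E" "u \<notin> E" "card E \<le> card U"
      using that assms finite_subset card_mono by (blast, blast, blast)
    then show "wt p (insert u U) E = (1 - p) * wt p U E" "wt p (insert u U) (insert u E) = p * wt p U E"
      using assms by (simp_all add: wt_def Suc_diff_le)
  qed
  have "(\<Sum>E\<in>Pow (insert u U). wt p (insert u U) E * f E) =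
      (\<Sum>E\<in>Pow U. wt p (insert u U) E * f E) + (\<Sum>E\<in>insert u ` Pow U. wt p (insert u U) E * f E)"
    unfolding Pow_insert using assms by (intro sum.union_disjoint) auto
  also have "(\<Sum>E\<in>insert u ` Pow U. wt p (insert u U) E * f E) =
      (\<Sum>E\<in>Pow U. wt p (insert u U) (insert u E) * f (insert u E))"
    using inj by (simp add: sum.reindex)
  also have "(\<Sum>E\<in>Pow U. wt p (insert u U) E * f E) + \<dots> =
      (\<Sum>E\<in>Pow U. wt p (insert u U) E * f E + wt p (insert u U) (insert u E) * f (insert u E))"
    by (simp add: sum.distrib)
  also have "\<dots> = (\<Sum>E\<in>Pow U. wt p U E * ((1 - p) * f E + p * f (insert u E)))"
    by (intro sum.cong refl) (simp add: w algebra_simps)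
  finally show ?thesis .
qed

lemma sum_wt: "finite U \<Longrightarrow> (\<Sum>E\<in>Pow U. wt p U E) = 1"
proof (induction U rule: finite_induct)
  case empty
  then show ?case by (simp add: wt_def)
next
  case (insert u U)
  then show ?case using sum_wt_insert[of U u p "\<lambda>_. 1"] by simp
qed

text \<open>Elements outside \<open>Q\<close> contribute total weight \<open>1\<close>. An
  exploration is such an event: it fixes the edges at the internal vertices and nothing
  else.\<close>

lemma sum_wt_trace:
  assumes "finite U" "R \<subseteq> Q" "Q \<subseteq> U"
  shows "(\<Sum>E\<in>{E \<in> Pow U. E \<inter> Q = R}. wt p U E) = p ^ card R * (1 - p) ^ (card Q - card R)"
proof -
  have fin: "finite Q" using finite_subset[OF assms(3,1)] .
  then have "finite R" using finite_subset[OF assms(2)] by simp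
  have eq: "{E \<in> Pow U. E \<inter> Q = R} = (\<lambda>D. R \<union> D) ` Pow (U - Q)"
  proof (intro set_eqI iffI)
    fix E assume "E \<in> {E \<in> Pow U. E \<inter> Q = R}"
    then have "E = R \<union> (E - Q)" "E - Q \<in> Pow (U - Q)" using assms by auto
    then show "E \<in> (\<lambda>D. R \<union> D) ` Pow (U - Q)" by blast
  qed (use assms in auto)
  have w: "wt p U (R \<union> D) = p ^ card R * (1 - p) ^ (card Q - card R) * wt p (U - Q) D"
    if D: "D \<subseteq> U - Q" for D
  proof -
    have "finite D" using D assms(1) by (meson finite_Diff finite_subset)
    then have c: "card (R \<union> D) = card R + card D" using D assms \<open>finite R\<close> by (intro card_Un_disjoint) auto
    have cU: "card (U - Q) = card U - card Q" using assms fin by (simp add: card_Diff_subset)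
    have le: "card R \<le> card Q" "card Q \<le> card U" "card D \<le> card U - card Q"
      using card_mono[OF fin assms(2)] card_mono[OF assms(1,3)] card_mono[OF _ D] assms(1) by (simp_all add: cU)
    have "card U - (card R + card D) = (card Q - card R) + (card U - card Q - card D)" using le by linarith
    then show ?thesis unfolding wt_def c cU by (simp add: power_add)
  qed
  have "inj_on (\<lambda>D. R \<union> D) (Pow (U - Q))" by (rule inj_on_inverseI[where g = "\<lambda>E. E - Q"]) (use assms in auto)
  then have "(\<Sum>E\<in>{E \<in> Pow U. E \<inter> Q = R}. wt p U E) = (\<Sum>D\<in>Pow (U - Q). wt p U (R \<union> D))"
    unfolding eq by (simp add: sum.reindex)
  also have "\<dots> = (\<Sum>D\<in>Pow (U - Q). p ^ card R * (1 - p) ^ (card Q - card R) * wt p (U - Q) D)"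
    using w by (intro sum.cong) auto
  also have "\<dots> = p ^ card R * (1 - p) ^ (card Q - card R) * (\<Sum>D\<in>Pow (U - Q). wt p (U - Q) D)"
    by (simp add: sum_distrib_left)
  finally show ?thesis using sum_wt[of "U - Q" p] assms(1) by simp
qed

lemma exp_le_quadratic: "exp x \<le> 1 + x + x\<^sup>2" if "\<bar>x\<bar> \<le> 1" for x :: real
proof (cases "x \<ge> 0")
  case True
  then show ?thesis using exp_bound[of x] that by simp
next
  case False
  define y where "y = - x"
  have y: "0 \<le> y" "y \<le> 1" using False that by (auto simp: y_def)
  have "1 + y \<le> exp y" by (rule exp_ge_add_one_self)
  then have "exp (- y) \<le> 1 / (1 + y)" using y by (simp add: exp_minus inverse_eq_divide frac_le)
  also have "\<dots> \<le> 1 - y + y\<^sup>2"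
  proof -
    have "(1 - y + y\<^sup>2) * (1 + y) = 1 + y ^ 3" by (simp add: algebra_simps power2_eq_square power3_eq_cube)
    then have "1 \<le> (1 - y + y\<^sup>2) * (1 + y)" using y by simp
    then show ?thesis using y by (simp add: divide_le_eq)
  qed
  finally show ?thesis by (simp add: y_def)
qed

text \<open>Elements are revealed one at a time; averaging over \<open>u\<close> gives
  \<open>g\<close>, again with differences at most \<open>K\<close>. As the two values have weights
  \<open>1 - p\<close> and \<open>p\<close>, each step costs only
  \<open>exp (p * (s * K)\<^sup>2)\<close>. The factor \<open>p\<close> is essential: the possible
  edges are quadratic in number, but \<open>p\<close> times their number is linear.\<close>

lemma mgf_bound:
  fixes p s K :: real and f :: "'a set \<Rightarrow> real"
  assumes "finite U" "0 \<le> p" "p \<le> 1" "\<bar>s\<bar> * K \<le> 1"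
    and "\<And>E u. E \<subseteq> U \<Longrightarrow> u \<in> U \<Longrightarrow> u \<notin> E \<Longrightarrow> \<bar>f (insert u E) - f E\<bar> \<le> K"
  shows "(\<Sum>E\<in>Pow U. wt p U E * exp (s * f E))
    \<le> exp (s * (\<Sum>E\<in>Pow U. wt p U E * f E) + p * (s * K)\<^sup>2 * card U)"
  using assms(1,5)
proof (induction U arbitrary: f rule: finite_induct)
  case empty
  then show ?case by (simp add: wt_def)
next
  case (insert u U)
  define g where "g E = (1 - p) * f E + p * f (insert u E)" for E
  have step: "(1 - p) * exp (s * f E) + p * exp (s * f (insert u E)) \<le> exp (s * g E) * exp (p * (s * K)\<^sup>2)"
    if E: "E \<subseteq> U" for E
  proof -
    define d where "d = s * (f (insert u E) - f E)"
    have "\<bar>f (insert u E) - f E\<bar> \<le> K" using insert.hyps E by (intro insert.prems) auto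
    then have "\<bar>d\<bar> \<le> \<bar>s\<bar> * K" unfolding d_def abs_mult by (intro mult_left_mono) auto
    then have d: "\<bar>d\<bar> \<le> 1" "d\<^sup>2 \<le> (s * K)\<^sup>2"
      using assms(4) power_mono[of "\<bar>d\<bar>" "\<bar>s\<bar> * K" 2] by (simp_all add: power_mult_distrib)
    have "(1 - p) * exp (s * f E) + p * exp (s * f (insert u E)) = exp (s * f E) * (1 + p * (exp d - 1))"
      by (simp add: d_def algebra_simps flip: exp_add)
    also have "\<dots> \<le> exp (s * f E) * exp (p * (exp d - 1))"
      by (intro mult_left_mono exp_ge_add_one_self) auto
    also have "\<dots> \<le> exp (s * f E) * exp (p * (d + (s * K)\<^sup>2))"
      using exp_le_quadratic[OF d(1)] d(2) assms(2) by (auto intro!: mult_left_mono)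
    also have "\<dots> = exp (s * g E) * exp (p * (s * K)\<^sup>2)"
      by (simp add: d_def g_def algebra_simps flip: exp_add)
    finally show ?thesis .
  qed
  have lip: "\<bar>g (insert v E) - g E\<bar> \<le> K" if "E \<subseteq> U" "v \<in> U" "v \<notin> E" for E v
  proof -
    have 1: "\<bar>f (insert v E) - f E\<bar> \<le> K" using that by (intro insert.prems) auto
    have 2: "\<bar>f (insert v (insert u E)) - f (insert u E)\<bar> \<le> K"
      using that insert.hyps by (intro insert.prems) auto
    have "g (insert v E) - g E = (1 - p) * (f (insert v E) - f E) + p * (f (insert v (insert u E)) - f (insert u E))"
      unfolding g_def insert_commute[of u v] by (simp add: algebra_simps)
    also have "\<bar>\<dots>\<bar> \<le> (1 - p) * \<bar>f (insert v E) - f E\<bar> + p * \<bar>f (insert v (insert u E)) - f (insert u E)\<bar>"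
      using assms(2,3) by (intro order_trans[OF abs_triangle_ineq]) (simp add: abs_mult)
    also have "\<dots> \<le> (1 - p) * K + p * K"
      using 1 2 assms(2,3) by (intro add_mono mult_left_mono) auto
    finally show ?thesis by (simp add: algebra_simps)
  qed
  have "(\<Sum>E\<in>Pow (insert u U). wt p (insert u U) E * exp (s * f E)) =
      (\<Sum>E\<in>Pow U. wt p U E * ((1 - p) * exp (s * f E) + p * exp (s * f (insert u E))))"
    by (rule sum_wt_insert) (use insert in auto)
  also have "\<dots> \<le> (\<Sum>E\<in>Pow U. wt p U E * (exp (s * g E) * exp (p * (s * K)\<^sup>2)))"
    using step wt_nonneg[OF assms(2,3)] by (intro sum_mono mult_left_mono) auto
  also have "\<dots> = (\<Sum>E\<in>Pow U. wt p U E * exp (s * g E)) * exp (p * (s * K)\<^sup>2)"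
    by (simp add: sum_distrib_right mult.assoc)
  also have "\<dots> \<le> exp (s * (\<Sum>E\<in>Pow U. wt p U E * g E) + p * (s * K)\<^sup>2 * card U) * exp (p * (s * K)\<^sup>2)"
    by (intro mult_right_mono insert.IH lip) auto
  also have "(\<Sum>E\<in>Pow U. wt p U E * g E) = (\<Sum>E\<in>Pow (insert u U). wt p (insert u U) E * f E)"
    unfolding g_def by (rule sum_wt_insert[symmetric]) (use insert in auto)
  also have "exp (s * (\<Sum>E\<in>Pow (insert u U). wt p (insert u U) E * f E) + p * (s * K)\<^sup>2 * card U) * exp (p * (s * K)\<^sup>2)
     = exp (s * (\<Sum>E\<in>Pow (insert u U). wt p (insert u U) E * f E) + p * (s * K)\<^sup>2 * card (insert u U))"
    using insert.hyps by (simp add: algebra_simps flip: exp_add)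
  finally show ?case .
qed

text \<open>Markov's inequality for \<open>exp (- s * f E)\<close>. The first entry of the minimum
  in \<open>s\<close> gives \<open>s * K \<le> 1\<close>, as the quadratic bound for
  \<open>exp\<close> requires; the second keeps the variance term below
  \<open>s * \<epsilon> * n / 2\<close>, half of the gain.\<close>

lemma lower_tail:
  fixes p K \<epsilon> n s :: real and f :: "'a set \<Rightarrow> real"
  assumes "finite U" "0 \<le> p" "p \<le> 1" "K > 0" "\<epsilon> > 0" "p * card U \<le> n"
    and "\<And>E u. E \<subseteq> U \<Longrightarrow> u \<in> U \<Longrightarrow> u \<notin> E \<Longrightarrow> \<bar>f (insert u E) - f E\<bar> \<le> K"
    and s: "s = min (1 / K) (\<epsilon> / (2 * K\<^sup>2))"
  shows "(\<Sum>E\<in>{E \<in> Pow U. f E \<le> (\<Sum>E\<in>Pow U. wt p U E * f E) - \<epsilon> * n}. wt p U E) \<le> exp (- (s * \<epsilon> / 2) * n)"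
proof -
  let ?M = "\<Sum>E\<in>Pow U. wt p U E * f E"
  have s0: "s > 0" using assms(4,5) by (simp add: s)
  have sK: "s * K \<le> 1" "s * K\<^sup>2 \<le> \<epsilon> / 2"
  proof -
    have "s * K \<le> 1 / K * K" using assms(4) by (intro mult_right_mono) (auto simp: s)
    then show "s * K \<le> 1" using assms(4) by simp
    have "s * K\<^sup>2 \<le> \<epsilon> / (2 * K\<^sup>2) * K\<^sup>2" by (intro mult_right_mono) (auto simp: s)
    then show "s * K\<^sup>2 \<le> \<epsilon> / 2" using assms(4) by simp
  qed
  have n0: "0 \<le> n" using assms(6) mult_nonneg_nonneg[OF assms(2), of "real (card U)"] by linarith
  have "(\<Sum>E\<in>{E \<in> Pow U. f E \<le> ?M - \<epsilon> * n}. wt p U E) \<le>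
      (\<Sum>E\<in>{E \<in> Pow U. f E \<le> ?M - \<epsilon> * n}. wt p U E * exp (- s * f E + s * (?M - \<epsilon> * n)))"
  proof (intro sum_mono)
    fix E assume "E \<in> {E \<in> Pow U. f E \<le> ?M - \<epsilon> * n}"
    then have "s * f E \<le> s * (?M - \<epsilon> * n)" using s0 by (intro mult_left_mono) auto
    then have "1 \<le> exp (- s * f E + s * (?M - \<epsilon> * n))" by simp
    then show "wt p U E \<le> wt p U E * exp (- s * f E + s * (?M - \<epsilon> * n))"
      using wt_nonneg[OF assms(2,3)] by (metis mult.right_neutral mult_left_mono)
  qed
  also have "\<dots> \<le> (\<Sum>E\<in>Pow U. wt p U E * exp (- s * f E + s * (?M - \<epsilon> * n)))"
    using assms(1) by (intro sum_mono2) (auto intro: mult_nonneg_nonneg wt_nonneg[OF assms(2,3)])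
  also have "\<dots> = (\<Sum>E\<in>Pow U. wt p U E * exp (- s * f E)) * exp (s * (?M - \<epsilon> * n))"
    unfolding exp_add sum_distrib_right by (simp add: mult.assoc)
  also have "\<dots> \<le> exp (- s * ?M + p * (- s * K)\<^sup>2 * card U) * exp (s * (?M - \<epsilon> * n))"
    using assms(1,2,3,7) sK(1) s0 by (intro mult_right_mono mgf_bound) auto
  also have "\<dots> = exp (s * (s * K\<^sup>2) * (p * card U) - s * \<epsilon> * n)"
    by (simp add: algebra_simps power2_eq_square flip: exp_add)
  also have "\<dots> \<le> exp (s * (\<epsilon> / 2) * n - s * \<epsilon> * n)"
    using s0 sK(2) assms(2,5,6) n0 by (intro iffD2[OF exp_le_cancel_iff] diff_right_mono mult_mono) auto
  also have "\<dots> = exp (- (s * \<epsilon> / 2) * n)" by (simp add: field_simps)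
  finally show ?thesis .
qed

section \<open>Roots that see a given plane tree, and the effect of one edge\<close>

definition occ :: "nat \<Rightarrow> otree \<Rightarrow> 'b::linorder set \<Rightarrow> 'b set set \<Rightarrow> 'b set" where
  "occ L t V E = {r. \<exists>\<phi>. explored L t E \<phi> \<and> siblings_mono t \<phi> \<and> \<phi> ` addrs t \<subseteq> V \<and> \<phi> [] = r}"

lemma occ_subset: "occ L t V E \<subseteq> V"
  unfolding occ_def addrs_def by auto

lemma occ_unique:
  assumes "r \<in> occ L t V E" "r \<in> occ L t' V E" "height_le L t" "height_le L t'"
  shows "t = t'"
  using assms explored_unique(1)[of L t E _ t'] unfolding occ_def by force

lemma occ_ball_iso_iff:
  assumes "r \<in> occ L t V E" "height_le L t" "l < L"
  shows "rooted_iso (ball (V, E) r l) r H s \<longleftrightarrow> rooted_iso (ball (tree_graph t) [] l) [] H s"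
  using assms explored_ball_iso_iff[of L t E _ V l H s] unfolding occ_def by auto

text \<open>The root is recovered from \<open>u\<close> by climbing: the parent is a neighbour of
  \<open>u\<close>, and \<open>u\<close>, being the image of an internal vertex, has at most
  \<open>card (addrs t)\<close> neighbours. Thus only boundedly many roots arise although degrees in
  \<open>E\<close> are unbounded.\<close>

lemma roots_through_bound:
  assumes "height_le L t" "a \<in> internal L t"
  shows "finite {\<phi> [] |\<phi>. explored L t E \<phi> \<and> \<phi> a = u} \<and>
    card {\<phi> [] |\<phi>. explored L t E \<phi> \<and> \<phi> a = u} \<le> card (addrs t) ^ length a"
  using assms(2)
proof (induction a arbitrary: u rule: rev_induct)
  case Nil
  have sub: "{\<phi> [] |\<phi>. explored L t E \<phi> \<and> \<phi> [] = u} \<subseteq> {u}" by auto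
  show ?case using finite_subset[OF sub] card_mono[OF _ sub] by simp
next
  case (snoc i b)
  let ?R = "\<lambda>a u. {\<phi> [] |\<phi>. explored L t E \<phi> \<and> \<phi> a = u}"
  have bi: "b @ [i] \<in> addrs t" "length (b @ [i]) < L" using snoc.prems by (auto simp: internal_def)
  then have b: "b \<in> internal L t" using addrs_snocD by (auto simp: internal_def)
  show ?case
  proof (cases "?R (b @ [i]) u = {}")
    case True
    show ?thesis unfolding True by simp
  next
    case False
    \<comment> \<open>One exploration through \<open>u\<close> already bounds the degree of
      \<open>u\<close>, and this bound serves all the others.\<close>
    then obtain \<psi> where \<psi>: "explored L t E \<psi>" "\<psi> (b @ [i]) = u" by auto
    let ?N = "{x. {u, x} \<in> E}"
    have "?N \<subseteq> \<psi> ` addrs t"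
      using explored_edge[OF \<psi>(1) assms(1) snoc.prems] \<psi>(2) by auto
    then have N: "finite ?N" "card ?N \<le> card (addrs t)"
      using finite_addrs[of t] finite_subset[of ?N "\<psi> ` addrs t"] surj_card_le[of "addrs t" ?N \<psi>] by auto
    have sub: "?R (b @ [i]) u \<subseteq> (\<Union>x\<in>?N. ?R b x)"
    proof
      fix r assume "r \<in> ?R (b @ [i]) u"
      then obtain \<phi> where \<phi>: "explored L t E \<phi>" "\<phi> (b @ [i]) = u" "r = \<phi> []" by auto
      have "{b @ [i], b} \<in> snd (tree_graph t)" using bi by (auto simp: tree_graph_edge)
      then have "{u, \<phi> b} \<in> E"
        using explored_edge[OF \<phi>(1) assms(1) snoc.prems, of "\<phi> b"] \<phi>(2) b by (auto simp: internal_def)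
      then show "r \<in> (\<Union>x\<in>?N. ?R b x)" using \<phi> by auto
    qed
    have fin: "finite (\<Union>x\<in>?N. ?R b x)" using N(1) snoc.IH[OF b] by blast
    have "card (?R (b @ [i]) u) \<le> card (\<Union>x\<in>?N. ?R b x)" by (rule card_mono[OF fin sub])
    also have "\<dots> \<le> (\<Sum>x\<in>?N. card (?R b x))" by (rule card_UN_le[OF N(1)])
    also have "\<dots> \<le> (\<Sum>x\<in>?N. card (addrs t) ^ length b)" using snoc.IH[OF b] by (intro sum_mono) auto
    also have "\<dots> \<le> card (addrs t) * card (addrs t) ^ length b" using N(2) by simp
    finally show ?thesis using finite_subset[OF sub fin] by simp
  qed
qed

text \<open>Union bound over the two ends of the changed edge and the internal addresses that may be
  mapped to them.\<close>

definition occ_lipschitz :: "nat \<Rightarrow> otree \<Rightarrow> nat" where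
  "occ_lipschitz L t = 2 * (\<Sum>a\<in>internal L t. card (addrs t) ^ length a)"

lemma touched_roots_bound:
  assumes "height_le L t" "card e = 2"
  shows "finite {\<phi> [] |\<phi>. explored L t E \<phi> \<and> e \<inter> \<phi> ` internal L t \<noteq> {}}" (is "finite ?T")
    and "card {\<phi> [] |\<phi>. explored L t E \<phi> \<and> e \<inter> \<phi> ` internal L t \<noteq> {}} \<le> occ_lipschitz L t"
proof -
  let ?R = "\<lambda>a u. {\<phi> [] |\<phi>. explored L t E \<phi> \<and> \<phi> a = u}"
  let ?S = "\<Union>(u, a)\<in>e \<times> internal L t. ?R a u"
  have fe: "finite e" using assms(2) by (metis card.infinite zero_neq_numeral)
  have f: "finite (e \<times> internal L t)" using fe finite_internal by blast
  have sub: "?T \<subseteq> ?S" by auto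
  have fin: "finite ?S"
  proof (rule finite_UN_I[OF f])
    fix q assume q: "q \<in> e \<times> internal L t"
    show "finite (case q of (u, a) \<Rightarrow> ?R a u)"
      using q roots_through_bound[OF assms(1), of "snd q" E "fst q"] by (cases q) simp
  qed
  show "finite ?T" using finite_subset[OF sub fin] .
  have "card ?T \<le> card ?S" by (rule card_mono[OF fin sub])
  also have "\<dots> \<le> (\<Sum>(u, a)\<in>e \<times> internal L t. card (?R a u))"
    using card_UN_le[OF f, of "\<lambda>(u, a). ?R a u"] by (simp add: case_prod_unfold)
  also have "\<dots> \<le> (\<Sum>(u, a)\<in>e \<times> internal L t. card (addrs t) ^ length a)"
    by (intro sum_mono) (auto intro!: conjunct2[OF roots_through_bound[OF assms(1)]])
  also have "\<dots> = occ_lipschitz L t"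
    using assms(2) by (simp add: sum.cartesian_product[symmetric] occ_lipschitz_def)
  finally show "card ?T \<le> occ_lipschitz L t" .
qed

text \<open>An exploration whose internal vertices avoid \<open>e\<close> is unaffected by
  \<open>e\<close>. A root gained or lost therefore has, in one of the two graphs, an exploration
  with an internal vertex on \<open>e\<close>.\<close>

lemma occ_insert:
  assumes "finite V" "height_le L t" "card e = 2"
  shows "\<bar>real (card (occ L t V (insert e E))) - real (card (occ L t V E))\<bar> \<le> occ_lipschitz L t"
proof -
  have fin: "finite (occ L t V E')" for E' using finite_subset[OF occ_subset assms(1)] .
  let ?T = "\<lambda>E. {\<phi> [] |\<phi>. explored L t E \<phi> \<and> e \<inter> \<phi> ` internal L t \<noteq> {}}"
  have same: "explored L t E \<phi> \<longleftrightarrow> explored L t (insert e E) \<phi>" if "e \<inter> \<phi> ` internal L t = {}" for \<phi>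
  proof -
    have "{e' \<in> insert e E. e' \<inter> \<phi> ` internal L t \<noteq> {}} = {e' \<in> E. e' \<inter> \<phi> ` internal L t \<noteq> {}}"
      using that by auto
    then show ?thesis by (simp add: explored_def)
  qed
  have 1: "occ L t V E \<subseteq> occ L t V (insert e E) \<union> ?T E"
    using same unfolding occ_def by blast
  have 2: "occ L t V (insert e E) \<subseteq> occ L t V E \<union> ?T (insert e E)"
    using same unfolding occ_def by blast
  have cU: "card A \<le> card B + card C" if "A \<subseteq> B \<union> C" "finite B" "finite C" for A B C :: "'a set"
    by (rule order_trans[OF card_mono card_Un_le]) (use that in auto)
  have "card (occ L t V E) \<le> card (occ L t V (insert e E)) + card (?T E)"
    by (rule cU[OF 1 fin touched_roots_bound(1)[OF assms(2,3)]])
  moreover have "card (occ L t V (insert e E)) \<le> card (occ L t V E) + card (?T (insert e E))"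
    by (rule cU[OF 2 fin touched_roots_bound(1)[OF assms(2,3)]])
  ultimately show ?thesis
    using touched_roots_bound(2)[OF assms(2,3), of E] touched_roots_bound(2)[OF assms(2,3), of "insert e E"]
    by linarith
qed

section \<open>Expected number of tree neighbourhoods\<close>

text \<open>Codes the embeddings of a tree at a given root: each internal vertex receives the set of
  its children's labels. Sibling order makes sets sufficient; extensionality makes different codes
  different functions.\<close>

definition disjoint_families :: "'a set \<Rightarrow> 'b set \<Rightarrow> ('a \<Rightarrow> nat) \<Rightarrow> ('a \<Rightarrow> 'b set) set" where
  "disjoint_families I W k =
     {S \<in> I \<rightarrow>\<^sub>E Pow W. (\<forall>a\<in>I. card (S a) = k a) \<and> disjoint_family_on S I}"

lemma finite_disjoint_families: "finite I \<Longrightarrow> finite W \<Longrightarrow> finite (disjoint_families I W k)"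
  unfolding disjoint_families_def by (rule finite_subset[OF _ finite_PiE[of I "\<lambda>_. Pow W"]]) auto

text \<open>Sets are chosen one after another. Together they use at most the sum of the
  \<open>k a\<close> elements, so \<open>N\<close> elements are always free; this replaces a
  multinomial count without changing the asymptotics.\<close>

lemma card_disjoint_families:
  assumes "finite I" "finite W" "N + (\<Sum>a\<in>I. k a) \<le> card W"
  shows "(\<Prod>a\<in>I. N choose k a) \<le> card (disjoint_families I W k)"
  using assms(1,3)
proof (induction I rule: finite_induct)
  case empty
  have "disjoint_families {} W k = {\<lambda>_. undefined}" by (auto simp: disjoint_families_def disjoint_family_on_def)
  then show ?case by simp
next
  case (insert a I)
  let ?T = "\<lambda>S. {T. T \<subseteq> W - (\<Union>b\<in>I. S b) \<and> card T = k a}"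
  let ?D = "SIGMA S : disjoint_families I W k. ?T S"
  let ?h = "\<lambda>(S, T). S(a := T)"
  have fin: "finite (?T S)" for S
    by (rule finite_subset[of _ "Pow W"]) (use assms(2) in auto)
  have inj: "inj_on ?h ?D"
  proof (rule inj_onI)
    fix x y assume x: "x \<in> ?D" and y: "y \<in> ?D" and eq: "?h x = ?h y"
    obtain S T S' T' where xy: "x = (S, T)" "y = (S', T')" by (metis prod.collapse)
    have "S a = undefined" "S' a = undefined"
      using x y insert.hyps unfolding xy disjoint_families_def by (auto simp: PiE_def extensional_def)
    moreover have e: "S(a := T) = S'(a := T')" using eq xy by simp
    ultimately have "S = S'" by (metis fun_upd_triv fun_upd_upd)
    moreover have "T = T'" using e by (metis fun_upd_same)
    ultimately show "x = y" using xy by simp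
  qed
  have sub: "?h ` ?D \<subseteq> disjoint_families (insert a I) W k"
  proof (rule subsetI, elim imageE)
    fix z x assume z: "z = ?h x" and x: "x \<in> ?D"
    obtain S T where xe: "x = (S, T)" by force
    have S: "S \<in> I \<rightarrow>\<^sub>E Pow W" "\<forall>b\<in>I. card (S b) = k b" "disjoint_family_on S I"
      and T: "T \<subseteq> W - (\<Union>b\<in>I. S b)" "card T = k a"
      using x unfolding xe disjoint_families_def by auto
    have "S(a := T) \<in> insert a I \<rightarrow>\<^sub>E Pow W" using S(1) T(1) by (intro PiE_fun_upd) auto
    moreover have "disjoint_family_on (S(a := T)) (insert a I)"
      using S(3) T(1) insert.hyps unfolding disjoint_family_on_def by auto
    ultimately show "z \<in> disjoint_families (insert a I) W k"
      using S(2) T(2) insert.hyps unfolding z xe disjoint_families_def by auto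
  qed
  have T: "N choose k a \<le> card (?T S)" if S: "S \<in> disjoint_families I W k" for S
  proof -
    have "card (\<Union>b\<in>I. S b) \<le> (\<Sum>b\<in>I. card (S b))" by (rule card_UN_le[OF insert.hyps(1)])
    also have "\<dots> = (\<Sum>b\<in>I. k b)" using S by (intro sum.cong) (auto simp: disjoint_families_def)
    finally have "card (\<Union>b\<in>I. S b) \<le> (\<Sum>b\<in>I. k b)" .
    moreover have "(\<Union>b\<in>I. S b) \<subseteq> W" using S by (auto simp: disjoint_families_def)
    then have "card W - card (\<Union>b\<in>I. S b) \<le> card (W - (\<Union>b\<in>I. S b))"
      by (intro diff_card_le_card_Diff finite_subset[OF _ assms(2)])
    ultimately have "card W - (\<Sum>b\<in>I. k b) \<le> card (W - (\<Union>b\<in>I. S b))" by linarith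
    then have "N \<le> card (W - (\<Union>b\<in>I. S b))" using insert by simp
    then show ?thesis using n_subsets[of "W - (\<Union>b\<in>I. S b)" "k a"] assms(2) by (simp add: binomial_right_mono)
  qed
  have IH: "(\<Prod>a\<in>I. N choose k a) \<le> card (disjoint_families I W k)"
    using insert by simp
  have "(\<Prod>b\<in>insert a I. N choose k b) = (N choose k a) * (\<Prod>b\<in>I. N choose k b)"
    using insert.hyps by simp
  also have "\<dots> \<le> (N choose k a) * card (disjoint_families I W k)" using IH by simp
  also have "\<dots> = (\<Sum>S\<in>disjoint_families I W k. N choose k a)" by simp
  also have "\<dots> \<le> (\<Sum>S\<in>disjoint_families I W k. card (?T S))" using T by (intro sum_mono) auto
  also have "\<dots> = card ?D"
    using finite_disjoint_families[OF insert.hyps(1) assms(2)] fin by (subst card_SigmaI) auto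
  also have "\<dots> \<le> card (disjoint_families (insert a I) W k)"
    using insert.hyps(1) assms(2) by (intro card_inj_on_le[OF inj sub] finite_disjoint_families) auto
  finally show ?case .
qed

text \<open>The embedding coded by \<open>S\<close>: the \<open>i\<close>-th child of
  \<open>b\<close> gets the \<open>i\<close>-th smallest element of \<open>S b\<close>, both counted
  from \<open>0\<close>.\<close>

definition labelling :: "'b::linorder \<Rightarrow> (nat list \<Rightarrow> 'b set) \<Rightarrow> nat list \<Rightarrow> 'b" where
  "labelling r S a = (if a = [] then r else sorted_list_of_set (S (butlast a)) ! last a)"

context
  fixes L :: nat and t :: otree and V :: "'b::linorder set" and r :: 'b and S
  assumes ht: "height_le L t" and V: "finite V" and r: "r \<in> V"
    and S: "S \<in> disjoint_families (internal L t) (V - {r}) (kids t)"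
begin

lemma addrs_cases_internal:
  assumes "a \<in> addrs t" "a \<noteq> []"
  obtains b i where "a = b @ [i]" "b \<in> internal L t" "i < kids t b"
proof -
  obtain b i where a: "a = b @ [i]" using assms(2) by (metis append_butlast_last_id)
  have "Suc (length b) \<le> L" using ht assms(1) a unfolding height_le_def by fastforce
  then have "b \<in> internal L t" "i < kids t b"
    using assms(1) a by (auto simp: internal_def addrs_def addr_in_snoc)
  then show ?thesis using that a by blast
qed

lemma S_props:
  assumes "b \<in> internal L t"
  shows "S b \<subseteq> V - {r}" "card (S b) = kids t b" "finite (S b)"
proof -
  show "S b \<subseteq> V - {r}" "card (S b) = kids t b"
    using S assms by (auto simp: disjoint_families_def)
  then show "finite (S b)" using V by (meson finite_Diff finite_subset)
qed

lemma labelling_snoc: "labelling r S (b @ [i]) = sorted_list_of_set (S b) ! i"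
  by (simp add: labelling_def)

lemma labelling_mem:
  assumes "b \<in> internal L t" "i < kids t b"
  shows "labelling r S (b @ [i]) \<in> S b"
  unfolding labelling_snoc using S_props[OF assms(1)] assms(2)
  by (metis nth_mem sorted_list_of_set.length_sorted_key_list_of_set sorted_list_of_set.set_sorted_key_list_of_set)

lemma labelling_children:
  assumes "b \<in> internal L t"
  shows "(\<lambda>i. labelling r S (b @ [i])) ` {..<kids t b} = S b"
proof -
  have "(\<lambda>i. sorted_list_of_set (S b) ! i) ` {..<length (sorted_list_of_set (S b))} = set (sorted_list_of_set (S b))"
    by (auto simp: set_conv_nth)
  then show ?thesis unfolding labelling_snoc using S_props[OF assms] by simp
qed

lemma labelling_inj: "inj_on (labelling r S) (addrs t)"
proof (rule inj_onI)
  have root: "labelling r S a \<noteq> r" if a: "a \<in> addrs t" "a \<noteq> []" for a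
  proof -
    obtain b i where "a = b @ [i]" "b \<in> internal L t" "i < kids t b" using addrs_cases_internal[OF a] .
    then show ?thesis using labelling_mem[of b i] S_props(1)[of b] by auto
  qed
  have rr: "labelling r S [] = r" by (simp add: labelling_def)
  fix x y assume x: "x \<in> addrs t" and y: "y \<in> addrs t" and eq: "labelling r S x = labelling r S y"
  show "x = y"
  proof (cases "x = [] \<or> y = []")
    case True
    then show ?thesis using root rr x y eq by metis
  next
    case False
    then obtain b i where b: "x = b @ [i]" "b \<in> internal L t" "i < kids t b" using addrs_cases_internal[OF x] by blast
    obtain c j where c: "y = c @ [j]" "c \<in> internal L t" "j < kids t c"
      using False addrs_cases_internal[OF y] by blast
    have "labelling r S x \<in> S b \<inter> S c" using labelling_mem[OF b(2,3)] labelling_mem[OF c(2,3)] b c eq by auto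
    then have bc: "b = c" using S b(2) c(2) unfolding disjoint_families_def disjoint_family_on_def by blast
    then have "sorted_list_of_set (S b) ! i = sorted_list_of_set (S b) ! j"
      using eq b(1) c(1) by (simp add: labelling_snoc)
    then have "i = j" using b(3) c(3) bc S_props[OF b(2)] by (simp add: nth_eq_iff_index_eq)
    then show ?thesis using b c bc by simp
  qed
qed

lemma labelling_siblings: "siblings_mono t (labelling r S)"
  unfolding siblings_mono_def
proof (intro allI impI)
  fix b and i j :: nat assume ij: "i < j" "b @ [j] \<in> addrs t"
  then obtain c k where "b @ [j] = c @ [k]" "c \<in> internal L t" "k < kids t c"
    using addrs_cases_internal by blast
  then have b: "b \<in> internal L t" "j < kids t b" by auto
  have sw: "sorted_wrt (<) (sorted_list_of_set (S b))" by simp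
  show "labelling r S (b @ [i]) < labelling r S (b @ [j])"
    unfolding labelling_snoc using b S_props[OF b(1)] by (intro sorted_wrt_nth_less[OF sw ij(1)]) auto
qed

lemma labelling_range: "labelling r S ` addrs t \<subseteq> V"
proof clarify
  fix a assume a: "a \<in> addrs t"
  show "labelling r S a \<in> V"
  proof (cases "a = []")
    case True
    then show ?thesis using r by (simp add: labelling_def)
  next
    case False
    then obtain b i where b: "a = b @ [i]" "b \<in> internal L t" "i < kids t b" using addrs_cases_internal[OF a] by blast
    then show ?thesis using labelling_mem[OF b(2,3)] S_props(1)[OF b(2)] by auto
  qed
qed

text \<open>An inequality suffices: for \<open>p \<le> 1\<close>, overestimating the number of edges
  only lowers the power of \<open>p\<close>.\<close>

lemma card_tree_edges: "card ((\<lambda>e. labelling r S ` e) ` snd (tree_graph t)) \<le> (\<Sum>a\<in>internal L t. kids t a)"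
proof -
  have "snd (tree_graph t) \<subseteq> (\<Union>a\<in>internal L t. (\<lambda>i. {a, a @ [i]}) ` {..<kids t a})"
  proof
    fix e assume "e \<in> snd (tree_graph t)"
    then obtain a i where e: "e = {a, a @ [i]}" "a @ [i] \<in> addrs t" by (auto simp: tree_graph_def addrs_def)
    then obtain b j where "a @ [i] = b @ [j]" "b \<in> internal L t" "j < kids t b"
      using addrs_cases_internal by blast
    then show "e \<in> (\<Union>a\<in>internal L t. (\<lambda>i. {a, a @ [i]}) ` {..<kids t a})" using e by auto
  qed
  moreover have fin: "finite (\<Union>a\<in>internal L t. (\<lambda>i. {a, a @ [i]}) ` {..<kids t a})" using finite_internal by auto
  ultimately have fin2: "finite (snd (tree_graph t))"
    and "card (snd (tree_graph t)) \<le> card (\<Union>a\<in>internal L t. (\<lambda>i. {a, a @ [i]}) ` {..<kids t a})"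
    by (rule finite_subset, intro card_mono)
  note this(2)
  also have "\<dots> \<le> (\<Sum>a\<in>internal L t. card ((\<lambda>i. {a, a @ [i]}) ` {..<kids t a}))"
    by (rule card_UN_le[OF finite_internal])
  also have "\<dots> \<le> (\<Sum>a\<in>internal L t. kids t a)"
    by (intro sum_mono order_trans[OF card_image_le]) auto
  finally show ?thesis using card_image_le[OF fin2] by (rule order_trans[rotated])
qed

text \<open>Whether the labelling is an exploration depends only on the trace of \<open>E\<close> on
  \<open>Q\<close>, the possible edges at internal vertices. There are at most \<open>card V\<close>
  of them per internal vertex, whence the power of \<open>1 - p\<close>.\<close>

lemma labelling_weight:
  assumes p: "0 \<le> p" "p \<le> 1"
  shows "p ^ (\<Sum>a\<in>internal L t. kids t a) * (1 - p) ^ (card V * card (internal L t)) \<le>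
    (\<Sum>E\<in>{E \<in> Pow (edges_on V). explored L t E (labelling r S)}. wt p (edges_on V) E)"
proof -
  let ?\<phi> = "labelling r S"
  define Q where "Q = {e \<in> edges_on V. e \<inter> ?\<phi> ` internal L t \<noteq> {}}"
  define R where "R = (\<lambda>e. ?\<phi> ` e) ` snd (tree_graph t)"
  have RQ: "R \<subseteq> Q"
  proof
    fix e assume "e \<in> R"
    then obtain a i where e: "e = {?\<phi> a, ?\<phi> (a @ [i])}" "a @ [i] \<in> addrs t"
      by (auto simp: R_def tree_graph_def addrs_def)
    then obtain b j where "a @ [i] = b @ [j]" "b \<in> internal L t" "j < kids t b"
      using addrs_cases_internal by blast
    then have a: "a \<in> internal L t" by auto
    have aa: "a \<in> addrs t" using e(2) by (rule addrs_snocD)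
    have "?\<phi> a \<noteq> ?\<phi> (a @ [i])"
      using inj_on_eq_iff[OF labelling_inj aa e(2)] by simp
    then show "e \<in> Q" using labelling_range aa e a by (auto simp: Q_def edges_on_def)
  qed
  have eq: "{E \<in> Pow (edges_on V). explored L t E ?\<phi>} = {E \<in> Pow (edges_on V). E \<inter> Q = R}"
  proof (rule Collect_cong, rule conj_cong[OF refl])
    fix E assume "E \<in> Pow (edges_on V)"
    then have E: "{e \<in> E. e \<inter> ?\<phi> ` internal L t \<noteq> {}} = E \<inter> Q" by (auto simp: Q_def)
    show "explored L t E ?\<phi> \<longleftrightarrow> E \<inter> Q = R"
      unfolding explored_def R_def E by (simp only: labelling_inj simp_thms)
  qed
  have fU: "finite (edges_on V)" using finite_edges_on[OF V] .
  have QU: "Q \<subseteq> edges_on V" by (auto simp: Q_def)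
  have "Q \<subseteq> (\<Union>a\<in>internal L t. (\<lambda>y. {?\<phi> a, y}) ` V)"
  proof
    fix e assume "e \<in> Q"
    then obtain a where a: "a \<in> internal L t" "?\<phi> a \<in> e" "e \<subseteq> V" "card e = 2"
      by (auto simp: Q_def edges_on_def)
    then obtain y where "e = {?\<phi> a, y}" by (auto simp: card_2_iff)
    then show "e \<in> (\<Union>a\<in>internal L t. (\<lambda>y. {?\<phi> a, y}) ` V)" using a by auto
  qed
  then have "card Q \<le> card (\<Union>a\<in>internal L t. (\<lambda>y. {?\<phi> a, y}) ` V)"
    by (rule card_mono[rotated]) (use V finite_internal in auto)
  also have "\<dots> \<le> (\<Sum>a\<in>internal L t. card ((\<lambda>y. {?\<phi> a, y}) ` V))" by (rule card_UN_le[OF finite_internal])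
  also have "\<dots> \<le> (\<Sum>a\<in>internal L t. card V)" by (intro sum_mono card_image_le V)
  finally have Q: "card Q \<le> card V * card (internal L t)" by (simp add: mult.commute)
  have "p ^ (\<Sum>a\<in>internal L t. kids t a) * (1 - p) ^ (card V * card (internal L t)) \<le>
      p ^ card R * (1 - p) ^ (card Q - card R)"
    using p Q card_tree_edges by (intro mult_mono power_decreasing) (auto simp: R_def)
  also have "\<dots> = (\<Sum>E\<in>{E \<in> Pow (edges_on V). E \<inter> Q = R}. wt p (edges_on V) E)"
    by (rule sum_wt_trace[OF fU RQ QU, symmetric])
  finally show ?thesis unfolding eq .
qed

end

text \<open>Makes the exploration events of different families disjoint, so that their weights add
  up: the exploration at \<open>r\<close> is unique, and \<open>S\<close> can be read off
  it.\<close>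

lemma labelling_unique:
  assumes "height_le L t" "finite V" "r \<in> V"
    and "S \<in> disjoint_families (internal L t) (V - {r}) (kids t)"
    and "S' \<in> disjoint_families (internal L t) (V - {r}) (kids t)"
    and "explored L t E (labelling r S)" "explored L t E (labelling r S')"
  shows "S = S'"
proof (rule PiE_ext)
  show "S \<in> internal L t \<rightarrow>\<^sub>E Pow (V - {r})" "S' \<in> internal L t \<rightarrow>\<^sub>E Pow (V - {r})"
    using assms(4,5) by (auto simp: disjoint_families_def)
  fix b assume b: "b \<in> internal L t"
  have eq: "labelling r S a = labelling r S' a" if "a \<in> addrs t" for a
    using explored_unique(2)[OF assms(6,1) labelling_siblings[OF assms(1-4)] assms(7,1) labelling_siblings[OF assms(1-3,5)] _ that]
    by (simp add: labelling_def)
  have "(\<lambda>i. labelling r S (b @ [i])) ` {..<kids t b} = (\<lambda>i. labelling r S' (b @ [i])) ` {..<kids t b}"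
    using b by (intro image_cong eq refl) (auto simp: internal_def addrs_def addr_in_snoc)
  then show "S b = S' b"
    using labelling_children[OF assms(1-4) b] labelling_children[OF assms(1-3,5) b] by simp
qed

text \<open>Linearity over roots and disjointness over families. Each factor is close to the
  binomial probability of \<open>kids t a\<close> successes and will tend to a Poisson weight. The
  \<open>1\<close> in the size condition reserves the root.\<close>

lemma occ_mean:
  assumes "finite V" "height_le L t" "0 \<le> p" "p \<le> 1"
    and N: "N + 1 + (\<Sum>a\<in>internal L t. kids t a) \<le> card V"
  shows "card V * (\<Prod>a\<in>internal L t. real (N choose kids t a) * p ^ kids t a * (1 - p) ^ card V)
    \<le> (\<Sum>E\<in>Pow (edges_on V). wt p (edges_on V) E * card (occ L t V E))"
proof -
  let ?U = "edges_on V" and ?I = "internal L t"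
  let ?F = "\<lambda>r. disjoint_families ?I (V - {r}) (kids t)"
  let ?c = "p ^ (\<Sum>a\<in>?I. kids t a) * (1 - p) ^ (card V * card ?I)"
  let ?ev = "\<lambda>r S. {E \<in> Pow ?U. explored L t E (labelling r S)}"
  have fU: "finite (Pow ?U)" using finite_edges_on[OF assms(1)] by simp
  have root: "(\<Prod>a\<in>?I. real (N choose kids t a) * p ^ kids t a * (1 - p) ^ card V)
      \<le> (\<Sum>E\<in>{E \<in> Pow ?U. r \<in> occ L t V E}. wt p ?U E)" if r: "r \<in> V" for r
  proof -
    have fF: "finite (?F r)" using finite_disjoint_families finite_internal assms(1) by blast
    have c0: "0 \<le> ?c" using assms(3,4) by simp
    have "(\<Prod>a\<in>?I. real (N choose kids t a) * p ^ kids t a * (1 - p) ^ card V) =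
        real (\<Prod>a\<in>?I. N choose kids t a) * ?c"
      by (simp add: prod.distrib power_sum power_mult prod_constant)
    also have "\<dots> \<le> real (card (?F r)) * ?c"
    proof (intro mult_right_mono c0 of_nat_mono card_disjoint_families finite_internal)
      show "N + sum (kids t) ?I \<le> card (V - {r})" using N r assms(1) by simp
    qed (use assms(1) in auto)
    also have "\<dots> = (\<Sum>S\<in>?F r. ?c)" by simp
    also have "\<dots> \<le> (\<Sum>S\<in>?F r. \<Sum>E\<in>?ev r S. wt p ?U E)"
      using labelling_weight[OF assms(2,1) r _ assms(3,4)] by (intro sum_mono) auto
    also have "\<dots> = (\<Sum>E\<in>(\<Union>S\<in>?F r. ?ev r S). wt p ?U E)"
    proof (rule sum.UNION_disjoint[symmetric, OF fF])
      show "\<forall>S\<in>?F r. finite (?ev r S)" by (intro ballI finite_subset[OF _ fU]) auto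
      show "\<forall>S\<in>?F r. \<forall>S'\<in>?F r. S \<noteq> S' \<longrightarrow> ?ev r S \<inter> ?ev r S' = {}"
        using labelling_unique[OF assms(2,1) r] by blast
    qed
    also have "\<dots> \<le> (\<Sum>E\<in>{E \<in> Pow ?U. r \<in> occ L t V E}. wt p ?U E)"
    proof (rule sum_mono2)
      show "finite {E \<in> Pow ?U. r \<in> occ L t V E}" using fU by simp
      show "(\<Union>S\<in>?F r. ?ev r S) \<subseteq> {E \<in> Pow ?U. r \<in> occ L t V E}"
      proof
        fix E assume "E \<in> (\<Union>S\<in>?F r. ?ev r S)"
        then obtain S where S: "S \<in> ?F r" "E \<in> Pow ?U" "explored L t E (labelling r S)" by auto
        then have "r \<in> occ L t V E"
          unfolding occ_def using labelling_siblings[OF assms(2,1) r S(1)] labelling_range[OF assms(2,1) r S(1)]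
          by (intro CollectI exI[of _ "labelling r S"]) (simp add: labelling_def[of r S "[]"])
        then show "E \<in> {E \<in> Pow ?U. r \<in> occ L t V E}" using S(2) by simp
      qed
    qed (use wt_nonneg[OF assms(3,4)] in auto)
    finally show ?thesis .
  qed
  have "card V * (\<Prod>a\<in>?I. real (N choose kids t a) * p ^ kids t a * (1 - p) ^ card V)
      \<le> (\<Sum>r\<in>V. \<Sum>E\<in>{E \<in> Pow ?U. r \<in> occ L t V E}. wt p ?U E)"
    using sum_mono[OF root] by simp
  also have "\<dots> = (\<Sum>r\<in>V. \<Sum>E\<in>Pow ?U. if r \<in> occ L t V E then wt p ?U E else 0)"
    by (simp only: sum.inter_filter[OF fU])
  also have "\<dots> = (\<Sum>E\<in>Pow ?U. \<Sum>r\<in>V. if r \<in> occ L t V E then wt p ?U E else 0)"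
    by (rule sum.swap)
  also have "\<dots> = (\<Sum>E\<in>Pow ?U. wt p ?U E * card (occ L t V E))"
  proof (rule sum.cong[OF refl])
    fix E :: "'a set set"
    have "{r \<in> V. r \<in> occ L t V E} = occ L t V E" using occ_subset[of L t V E] by blast
    then show "(\<Sum>r\<in>V. if r \<in> occ L t V E then wt p ?U E else 0) = wt p ?U E * card (occ L t V E)"
      using assms(1) by (simp add: sum.inter_filter[symmetric])
  qed
  finally show ?thesis .
qed

section \<open>Local convergence\<close>

lemma planar_graphs_subset: "planar_graphs n m \<subseteq> {E \<in> Pow (edges_on {1..n}). card E = m}"
  unfolding planar_graphs_def simple_graph_def edges_on_def by auto

lemma finite_planar_graphs: "finite (planar_graphs n m)"
  by (rule finite_subset[OF planar_graphs_subset]) (simp add: finite_edges_on)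

lemma forests_subset_planar_graphs: "forests {1..n} m \<subseteq> planar_graphs n m"
proof
  fix E assume "E \<in> forests {1..n} m"
  then have "E \<subseteq> edges_on {1..n}" "card E = m" "forest E" by (auto simp: forests_def)
  then show "E \<in> planar_graphs n m"
    using planar_forest[of "{1..n}" E] by (auto simp: planar_graphs_def simple_graph_def edges_on_def)
qed

lemma binomial_scaled_limit:
  "(\<lambda>n. real ((n - d) choose k) / real n ^ k) \<longlonglongrightarrow> 1 / fact k"
proof -
  have "(\<lambda>n. (\<Prod>i<k. (real (n - d) - real i) / real n) / fact k) \<longlonglongrightarrow> (\<Prod>i<k. 1) / fact k"
  proof (intro tendsto_intros)
    fix i
    have "(\<lambda>n. (real n - real d - real i) / real n) \<longlonglongrightarrow> 1" by real_asymp
    moreover have "\<forall>\<^sub>F n in sequentially. (real n - real d - real i) / real n = (real (n - d) - real i) / real n"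
      using eventually_ge_at_top[of d] by eventually_elim simp
    ultimately show "(\<lambda>n. (real (n - d) - real i) / real n) \<longlonglongrightarrow> 1" by (rule Lim_transform_eventually)
  qed simp
  moreover have "real ((n - d) choose k) / real n ^ k = (\<Prod>i<k. (real (n - d) - real i) / real n) / fact k" for n
    by (simp add: binomial_gbinomial gbinomial_prod_rev prod_dividef atLeast0LessThan)
  ultimately show ?thesis by simp
qed

lemma power_one_minus_limit:
  fixes p :: "nat \<Rightarrow> real"
  assumes "(\<lambda>n. real n * p n) \<longlonglongrightarrow> c" "\<And>n. 0 \<le> p n"
  shows "(\<lambda>n. (1 - p n) ^ n) \<longlonglongrightarrow> exp (- c)"
proof -
  have p: "p \<longlonglongrightarrow> 0"
  proof -
    have "(\<lambda>n. (real n * p n) * (1 / real n)) \<longlonglongrightarrow> c * 0"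
      by (intro tendsto_mult assms(1)) real_asymp
    moreover have "\<forall>\<^sub>F n in sequentially. (real n * p n) * (1 / real n) = p n"
      using eventually_gt_at_top[of 0] by eventually_elim simp
    ultimately show ?thesis by (auto intro: Lim_transform_eventually)
  qed
  have ev: "\<forall>\<^sub>F n in sequentially. p n \<le> 1 / 2"
    using order_tendstoD(2)[OF p, of "1 / 2"] by (auto elim: eventually_mono)
  show ?thesis
  proof (rule tendsto_sandwich)
    show "\<forall>\<^sub>F n in sequentially. exp (- (real n * p n) - 2 * ((real n * p n) * p n)) \<le> (1 - p n) ^ n"
      using ev
    proof eventually_elim
      case (elim n)
      have "exp (- (real n * p n) - 2 * ((real n * p n) * p n)) = exp (- p n - 2 * (p n)\<^sup>2) ^ n"
        by (simp add: exp_of_nat_mult[symmetric] power2_eq_square algebra_simps)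
      also have "\<dots> \<le> (1 - p n) ^ n" using one_minus_ge_exp[OF assms(2) elim] by (intro power_mono) auto
      finally show ?case .
    qed
    show "\<forall>\<^sub>F n in sequentially. (1 - p n) ^ n \<le> exp (- (real n * p n))"
      using ev
    proof eventually_elim
      case (elim n)
      have "(1 - p n) ^ n \<le> exp (- p n) ^ n"
        using exp_ge_add_one_self[of "- p n"] elim by (intro power_mono) auto
      then show ?case by (simp add: exp_of_nat_mult[symmetric])
    qed
    have "(\<lambda>n. exp (- (real n * p n) - 2 * ((real n * p n) * p n))) \<longlonglongrightarrow> exp (- c - 2 * (c * 0))"
      by (intro tendsto_intros assms(1) p)
    then show "(\<lambda>n. exp (- (real n * p n) - 2 * ((real n * p n) * p n))) \<longlonglongrightarrow> exp (- c)" by simp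
    show "(\<lambda>n. exp (- (real n * p n))) \<longlonglongrightarrow> exp (- c)" by (intro tendsto_intros assms(1))
  qed
qed

text \<open>At \<open>c = 0\<close> the formula is the point mass at \<open>0\<close> because
  \<open>0 ^ 0 = 1\<close>, so the limits need no case distinction.\<close>

lemma pmf_poisson_offspring:
  assumes "0 \<le> c"
  shows "pmf (poisson_offspring c) k = c ^ k / fact k * exp (- c)"
proof (cases "c = 0")
  case True
  then show ?thesis by (auto simp: poisson_offspring_def indicator_def power_0_left)
next
  case False
  then show ?thesis using assms by (simp add: poisson_offspring_def)
qed

section \<open>Asymptotics for the given numbers of edges\<close>

context
  fixes m :: "nat \<Rightarrow> nat" and c :: real and p :: "nat \<Rightarrow> real"
  assumes c: "0 \<le> c" "c \<le> 1" and lim: "(\<lambda>n. 2 * real (m n) / real n) \<longlonglongrightarrow> c"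
    and p: "p = (\<lambda>n. 2 * real (m n) / real n ^ 2)"
begin

lemma np_limit: "(\<lambda>n. real n * p n) \<longlonglongrightarrow> c"
proof -
  have "real n * p n = 2 * real (m n) / real n" for n by (simp add: p power2_eq_square)
  then show ?thesis using lim by simp
qed

lemma p_nonneg: "0 \<le> p n"
  by (simp add: p)

lemma eventually_m_le:
  assumes "0 < \<delta>"
  shows "\<forall>\<^sub>F n in sequentially. real (m n) \<le> (1 / 2 + \<delta>) * real n"
proof -
  have "c < 1 + 2 * \<delta>" using c assms by simp
  then have "\<forall>\<^sub>F n in sequentially. 2 * real (m n) / real n < 1 + 2 * \<delta>" by (rule order_tendstoD(2)[OF lim])
  then show ?thesis using eventually_gt_at_top[of 0]
  proof eventually_elim
    case (elim n)
    then have "2 * real (m n) < (1 + 2 * \<delta>) * real n" by (simp add: divide_less_eq)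
    then show ?case by (simp add: algebra_simps)
  qed
qed

lemma eventually_m_le_self: "\<forall>\<^sub>F n in sequentially. real (m n) \<le> real n"
  using eventually_m_le[of "1 / 2"] by simp

lemma eventually_p_le_1: "\<forall>\<^sub>F n in sequentially. p n \<le> 1"
  using eventually_m_le_self eventually_ge_at_top[of 2]
proof eventually_elim
  case (elim n)
  then have "2 * real (m n) \<le> 2 * real n" by simp
  also have "\<dots> \<le> real n ^ 2" using elim(2) unfolding power2_eq_square by (intro mult_right_mono) auto
  finally show ?case using elim(2) by (simp add: p divide_le_eq)
qed

text \<open>At most \<open>2 * \<delta> * n + 1\<close> edges lie beyond the subcritical range. At
  \<open>e^(-4)\<close> each they cost \<open>e^(-8 * \<delta> * n - 4)\<close>, which turns the
  constant \<open>5\<close> into \<open>9\<close> and uses half of \<open>\<gamma>\<close>; the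
  other half absorbs all factors independent of \<open>n\<close> and the
  \<open>1 / n\<close>.\<close>

lemma eventually_forest_weight:
  assumes "0 < \<gamma>"
  shows "\<forall>\<^sub>F n in sequentially. exp (- \<gamma> * real n) \<le> real (card (forests {1..n} (m n))) *
     (p n ^ m n * (1 - p n) ^ (card (edges_on {1..n}) - m n))"
proof -
  \<comment> \<open>\<open>1 / 10\<close> keeps \<open>(1 / 2 + \<delta>) * n\<close> within
    \<open>3 / 5 * n\<close>; \<open>\<gamma> / 16\<close> gives
    \<open>8 * \<delta> \<le> \<gamma> / 2\<close>.\<close>
  define \<delta> where "\<delta> = min (1 / 10) (\<gamma> / 16)"
  have \<delta>: "0 < \<delta>" "\<delta> < 1" "\<delta> \<le> 1 / 10" "8 * \<delta> \<le> \<gamma> / 2" using assms by (auto simp: \<delta>_def)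
  have e1: "\<forall>\<^sub>F n in sequentially. 1 \<le> \<delta>\<^sup>2 * real n" using \<delta>(1) by real_asymp
  have e2: "\<forall>\<^sub>F n in sequentially. 2 \<le> \<delta> * real n" using \<delta>(1) by real_asymp
  have e3: "\<forall>\<^sub>F n in sequentially. exp (- \<gamma> * real n) \<le> exp (- 9 - 2 / \<delta> - \<gamma> / 2 * real n) / real n"
    using assms by real_asymp
  show ?thesis using e1 e2 e3 eventually_m_le[OF \<delta>(1)] eventually_ge_at_top[of 7]
  proof eventually_elim
    case (elim n)
    define k where "k = min (m n) (nat \<lfloor>(1 - 2 * \<delta>) * real n / 2\<rfloor>)"
    have pos: "0 \<le> (1 - 2 * \<delta>) * real n / 2" using \<delta>(3) by simp
    have fl: "real (nat \<lfloor>(1 - 2 * \<delta>) * real n / 2\<rfloor>) \<le> (1 - 2 * \<delta>) * real n / 2"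
      "(1 - 2 * \<delta>) * real n / 2 - 1 \<le> real (nat \<lfloor>(1 - 2 * \<delta>) * real n / 2\<rfloor>)"
      using pos by linarith+
    have "real k \<le> real (nat \<lfloor>(1 - 2 * \<delta>) * real n / 2\<rfloor>)" by (simp add: k_def)
    then have k1: "2 * real k \<le> (1 - 2 * \<delta>) * real n" using fl(1) by linarith
    have k2: "real (m n - k) \<le> 2 * \<delta> * real n + 1"
    proof (cases "m n \<le> nat \<lfloor>(1 - 2 * \<delta>) * real n / 2\<rfloor>")
      case True
      then show ?thesis using \<delta>(1) by (simp add: k_def)
    next
      case False
      then have "real (m n - k) = real (m n) - real (nat \<lfloor>(1 - 2 * \<delta>) * real n / 2\<rfloor>)" by (simp add: k_def)
      then show ?thesis using fl(2) elim(4) by (simp add: algebra_simps)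
    qed
    have "\<delta> * real n \<le> 1 / 10 * real n" using \<delta>(3) by (intro mult_right_mono) auto
    then have m35: "real (m n) \<le> 3 / 5 * real n" using elim(4) by (simp add: algebra_simps)
    have "8 * \<delta> * real n \<le> \<gamma> / 2 * real n" using \<delta>(4) by (intro mult_right_mono) auto
    then have "exp (- 9 - 2 / \<delta> - \<gamma> / 2 * real n) / real n \<le> exp (- 5 - 2 / \<delta> - 4 * real (m n - k)) / real n"
      using k2 by (intro divide_right_mono) auto
    also have "\<dots> \<le> real (card (forests {1..n} (m n))) * (p n ^ m n * (1 - p n) ^ (card (edges_on {1..n}) - m n))"
      using elim m35 k1 \<delta> by (intro forest_weight) (auto simp: p k_def)
    finally show ?case using elim(3) by simp
  qed
qed

lemma occ_mean_limit:
  assumes "height_le L t"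
  shows "(\<lambda>n. \<Prod>a\<in>internal L t. real ((n - (1 + (\<Sum>a\<in>internal L t. kids t a))) choose kids t a) * p n ^ kids t a * (1 - p n) ^ n)
    \<longlonglongrightarrow> pmf (gw_tree c L) t"
proof -
  let ?d = "1 + (\<Sum>a\<in>internal L t. kids t a)"
  have "(\<lambda>n. \<Prod>a\<in>internal L t. real ((n - ?d) choose kids t a) * p n ^ kids t a * (1 - p n) ^ n)
    \<longlonglongrightarrow> (\<Prod>a\<in>internal L t. 1 / fact (kids t a) * c ^ kids t a * exp (- c))"
  proof (rule tendsto_prod)
    fix a
    let ?k = "kids t a"
    have "(\<lambda>n. real ((n - ?d) choose ?k) / real n ^ ?k * (real n * p n) ^ ?k) \<longlonglongrightarrow> 1 / fact ?k * c ^ ?k"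
      by (intro tendsto_mult binomial_scaled_limit tendsto_power np_limit)
    moreover have "\<forall>\<^sub>F n in sequentially. real ((n - ?d) choose ?k) / real n ^ ?k * (real n * p n) ^ ?k =
        real ((n - ?d) choose ?k) * p n ^ ?k"
      using eventually_gt_at_top[of 0] by eventually_elim (simp add: power_mult_distrib)
    ultimately have "(\<lambda>n. real ((n - ?d) choose ?k) * p n ^ ?k) \<longlonglongrightarrow> 1 / fact ?k * c ^ ?k"
      by (rule Lim_transform_eventually)
    then show "(\<lambda>n. real ((n - ?d) choose ?k) * p n ^ ?k * (1 - p n) ^ n) \<longlonglongrightarrow> 1 / fact ?k * c ^ ?k * exp (- c)"
      by (rule tendsto_mult[OF _ power_one_minus_limit[OF np_limit p_nonneg]])
  qed
  then show ?thesis using assms by (simp add: pmf_gw_tree pmf_poisson_offspring[OF c(1)])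
qed

text \<open>\<open>\<eta>\<close> is spent in three equal parts: on replacing the mean by its limit,
  on the deviation below the mean, and on the fraction of bad planar graphs. The common weight
  \<open>w\<close> translates weights into numbers of graphs.\<close>

lemma planar_occ_lower_bound:
  assumes "0 < \<eta>" and ht: "height_le L t"
  shows "\<forall>\<^sub>F n in sequentially. pmf (gw_tree c L) t - \<eta> \<le>
    measure_pmf.prob (pmf_of_set (planar_graphs n (m n) \<times> {1..n})) {(E, r). r \<in> occ L t {1..n} E}"
proof -
  define \<epsilon> where "\<epsilon> = \<eta> / 3"
  define q where "q = pmf (gw_tree c L) t"
  \<comment> \<open>The \<open>+ 1\<close> keeps \<open>K\<close> positive; the Lipschitz constant
    is \<open>0\<close> if there are no internal vertices.\<close>
  define K where "K = real (occ_lipschitz L t) + 1"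
  define s where "s = min (1 / K) (\<epsilon> / (2 * K\<^sup>2))"
  define \<sigma> where "\<sigma> = s * \<epsilon> / 2"
  define d where "d = 1 + (\<Sum>a\<in>internal L t. kids t a)"
  have \<epsilon>: "0 < \<epsilon>" using assms(1) by (simp add: \<epsilon>_def)
  have K: "0 < K" by (simp add: K_def)
  have "0 < s" using \<epsilon> K by (simp add: s_def)
  then have \<sigma>: "0 < \<sigma>" using \<epsilon> by (simp add: \<sigma>_def)
  have q1: "q \<le> 1" by (simp add: q_def pmf_le_1)
  have e1: "\<forall>\<^sub>F n in sequentially. q - \<epsilon> < (\<Prod>a\<in>internal L t. real ((n - d) choose kids t a) * p n ^ kids t a * (1 - p n) ^ n)"
    using order_tendstoD(1)[OF occ_mean_limit[OF ht], of "q - \<epsilon>"] \<epsilon> unfolding q_def d_def by simp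
  \<comment> \<open>Half of the tail exponent \<open>\<sigma>\<close> is outweighed by the forests;
    the other half makes the remaining factor smaller than \<open>\<epsilon>\<close>.\<close>
  have e2: "\<forall>\<^sub>F n in sequentially. exp (- (\<sigma> / 2) * real n) \<le> real (card (forests {1..n} (m n))) *
     (p n ^ m n * (1 - p n) ^ (card (edges_on {1..n}) - m n))"
    using eventually_forest_weight[of "\<sigma> / 2"] \<sigma> by simp
  have e3: "\<forall>\<^sub>F n in sequentially. exp (- (\<sigma> / 2) * real n) \<le> \<epsilon>" using \<sigma> \<epsilon> by real_asymp
  show ?thesis using e1 e2 e3 eventually_m_le_self eventually_p_le_1 eventually_ge_at_top[of "max d 1"]
  proof eventually_elim
    case (elim n)
    let ?V = "{1..n}" and ?U = "edges_on {1..n}" and ?PG = "planar_graphs n (m n)"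
    let ?X = "\<lambda>E. real (card (occ L t ?V E))"
    define w where "w = p n ^ m n * (1 - p n) ^ (card ?U - m n)"
    define M where "M = (\<Sum>E\<in>Pow ?U. wt (p n) ?U E * ?X E)"
    define Bad where "Bad = {E \<in> ?PG. ?X E \<le> M - \<epsilon> * real n}"
    have fU: "finite ?U" by (simp add: finite_edges_on)
    have n0: "0 < n" using elim(6) by simp
    have w0: "0 \<le> w" using p_nonneg elim(5) by (simp add: w_def)
    have finPG: "finite ?PG" by (rule finite_planar_graphs)
    have "real n * (q - \<epsilon>) \<le> real n * (\<Prod>a\<in>internal L t. real ((n - d) choose kids t a) * p n ^ kids t a * (1 - p n) ^ n)"
      using elim(1) by (intro mult_left_mono) auto
    also have "\<dots> \<le> M"
      using occ_mean[of ?V L t "p n" "n - d"] ht p_nonneg elim(5,6) by (simp add: M_def d_def)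
    finally have M: "real n * (q - \<epsilon>) \<le> M" .
    have pU: "p n * real (card ?U) \<le> real n"
    proof -
      have "real (2 * card ?U) \<le> real (n ^ 2)" using card_edges_on[of ?V n] unfolding of_nat_le_iff by simp
      then have "p n * (2 * real (card ?U)) \<le> p n * real n ^ 2" using p_nonneg by (intro mult_left_mono) auto
      also have "\<dots> = 2 * real (m n)" using n0 by (simp add: p)
      finally show ?thesis using elim(4) by simp
    qed
    have "(\<Sum>E\<in>{E \<in> Pow ?U. ?X E \<le> M - \<epsilon> * real n}. wt (p n) ?U E) \<le> exp (- (s * \<epsilon> / 2) * real n)"
      unfolding M_def
    proof (rule lower_tail[OF fU p_nonneg elim(5) K \<epsilon> pU])
      fix E u assume "E \<subseteq> ?U" "u \<in> ?U" "u \<notin> E"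
      then have "card u = 2" by (simp add: edges_on_def)
      then have "\<bar>?X (insert u E) - ?X E\<bar> \<le> real (occ_lipschitz L t)" by (intro occ_insert ht) auto
      then show "\<bar>?X (insert u E) - ?X E\<bar> \<le> K" by (simp add: K_def)
    qed (simp add: s_def)
    then have tail: "(\<Sum>E\<in>{E \<in> Pow ?U. ?X E \<le> M - \<epsilon> * real n}. wt (p n) ?U E) \<le> exp (- \<sigma> * real n)"
      by (simp add: \<sigma>_def)
    have wPG: "wt (p n) ?U E = w" if "E \<in> ?PG" for E
      using that planar_graphs_subset[of n "m n"] by (auto simp: wt_def w_def)
    have "real (card Bad) * w = (\<Sum>E\<in>Bad. wt (p n) ?U E)"
      using wPG by (simp add: Bad_def)
    also have "\<dots> \<le> (\<Sum>E\<in>{E \<in> Pow ?U. ?X E \<le> M - \<epsilon> * real n}. wt (p n) ?U E)"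
      using planar_graphs_subset[of n "m n"] fU wt_nonneg[OF p_nonneg elim(5)]
      by (intro sum_mono2) (auto simp: Bad_def)
    also have "\<dots> \<le> exp (- \<sigma> * real n)" by (rule tail)
    also have "\<dots> = exp (- (\<sigma> / 2) * real n) * exp (- (\<sigma> / 2) * real n)" by (simp flip: exp_add)
    also have "\<dots> \<le> \<epsilon> * (real (card (forests ?V (m n))) * w)"
      using elim(2,3) \<epsilon> unfolding w_def by (intro mult_mono) auto
    also have "\<dots> \<le> \<epsilon> * (real (card ?PG) * w)"
      using \<epsilon> w0 card_mono[OF finPG forests_subset_planar_graphs]
      by (intro mult_left_mono mult_right_mono) auto
    finally have "real (card Bad) * w \<le> (\<epsilon> * real (card ?PG)) * w" by simp
    moreover have "0 < w"
    proof -
      have "0 < real (card (forests ?V (m n))) * w"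
        using elim(2) unfolding w_def by (rule less_le_trans[OF exp_gt_zero])
      then show ?thesis using w0 by (metis less_eq_real_def mult_zero_right order_less_irrefl)
    qed
    ultimately have bad: "real (card Bad) \<le> \<epsilon> * real (card ?PG)" by simp
    \<comment> \<open>The positive weight also shows that the planar graphs to choose from exist,
      without which \<open>pmf_of_set\<close> is not a uniform law.\<close>
    have "0 < real (card (forests ?V (m n))) * w"
      using elim(2) unfolding w_def by (rule less_le_trans[OF exp_gt_zero])
    then have "forests ?V (m n) \<noteq> {}" by auto
    then have ne: "?PG \<noteq> {}" using forests_subset_planar_graphs by blast
    then have cPG: "0 < card ?PG" using finPG by (simp add: card_gt_0_iff)
    have pr: "measure_pmf.prob (pmf_of_set (?PG \<times> ?V)) {(E, r). r \<in> occ L t ?V E} =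
        (\<Sum>E\<in>?PG. ?X E) / (real (card ?PG) * real n)"
    proof -
      have "(?PG \<times> ?V) \<inter> {(E, r). r \<in> occ L t ?V E} = (SIGMA E : ?PG. occ L t ?V E)"
        using occ_subset by fastforce
      moreover have "finite (occ L t ?V E)" for E by (rule finite_subset[OF occ_subset]) simp
      ultimately have "card ((?PG \<times> ?V) \<inter> {(E, r). r \<in> occ L t ?V E}) = (\<Sum>E\<in>?PG. card (occ L t ?V E))"
        using finPG by (simp add: card_SigmaI)
      then show ?thesis
        using ne finPG n0 by (subst measure_pmf_of_set) (auto simp: card_cartesian_product)
    qed
    show "pmf (gw_tree c L) t - \<eta> \<le>
      measure_pmf.prob (pmf_of_set (?PG \<times> ?V)) {(E, r). r \<in> occ L t ?V E}"
    \<comment> \<open>Trivial case. Otherwise the positive sign allows the number of good graphs to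
      be replaced by its lower bound.\<close>
    proof (cases "q - 2 * \<epsilon> \<le> 0")
      case True
      then have "pmf (gw_tree c L) t - \<eta> \<le> 0" using \<epsilon> by (simp add: q_def \<epsilon>_def)
      then show ?thesis using measure_nonneg order_trans by blast
    next
      case False
      have g0: "0 \<le> (q - 2 * \<epsilon>) * real n" using False by simp
      have "(q - 3 * \<epsilon>) * (real (card ?PG) * real n) \<le> (1 - \<epsilon>) * real (card ?PG) * ((q - 2 * \<epsilon>) * real n)"
      proof -
        have "\<epsilon> * (q - 2 * \<epsilon>) \<le> \<epsilon>" using \<epsilon> q1 by (simp add: mult_left_le)
        then have "q - 3 * \<epsilon> \<le> (1 - \<epsilon>) * (q - 2 * \<epsilon>)" by (simp add: algebra_simps)
        then have "(q - 3 * \<epsilon>) * (real (card ?PG) * real n) \<le> (1 - \<epsilon>) * (q - 2 * \<epsilon>) * (real (card ?PG) * real n)"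
          by (intro mult_right_mono) auto
        then show ?thesis by (simp add: mult_ac)
      qed
      also have "\<dots> \<le> real (card (?PG - Bad)) * ((q - 2 * \<epsilon>) * real n)"
      proof (intro mult_right_mono g0)
        have "card (?PG - Bad) = card ?PG - card Bad"
          using finPG by (intro card_Diff_subset) (auto simp: Bad_def)
        then show "(1 - \<epsilon>) * real (card ?PG) \<le> real (card (?PG - Bad))" using bad by (simp add: algebra_simps)
      qed
      also have "\<dots> = (\<Sum>E\<in>?PG - Bad. (q - 2 * \<epsilon>) * real n)" by simp
      also have "\<dots> \<le> (\<Sum>E\<in>?PG - Bad. ?X E)"
        using M by (intro sum_mono) (auto simp: Bad_def algebra_simps)
      also have "\<dots> \<le> (\<Sum>E\<in>?PG. ?X E)" using finPG by (intro sum_mono2) auto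
      finally have "q - 3 * \<epsilon> \<le> (\<Sum>E\<in>?PG. ?X E) / (real (card ?PG) * real n)"
        using cPG n0 by (simp add: pos_le_divide_eq)
      then show ?thesis unfolding pr by (simp add: q_def \<epsilon>_def)
    qed
  qed
qed

text \<open>The bounds for single trees are not uniform in the tree, so only finitely many are
  added: a finite part of \<open>T\<close> carrying all but \<open>\<eta> / 2\<close> of its mass,
  with the other half of \<open>\<eta>\<close> shared among its members.\<close>

lemma planar_trees_lower_bound:
  assumes "0 < \<eta>"
  shows "\<forall>\<^sub>F n in sequentially. measure_pmf.prob (gw_tree c L) T - \<eta> \<le>
    measure_pmf.prob (pmf_of_set (planar_graphs n (m n) \<times> {1..n}))
      {(E, r). \<exists>t\<in>T. height_le L t \<and> r \<in> occ L t {1..n} E}"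
proof -
  let ?q = "pmf (gw_tree c L)"
  let ?A = "\<lambda>n t. {(E, r). r \<in> occ L t {1..n} E}"
  let ?P = "\<lambda>n. measure_pmf.prob (pmf_of_set (planar_graphs n (m n) \<times> {1..n}))"
  have abs: "Infinite_Sum.abs_summable_on ?q T"
    by (simp only: abs_summable_equivalent pmf_abs_summable)
  then have "?q summable_on T" by (rule abs_summable_summable)
  then have "(?q has_sum infsum ?q T) T" by (rule has_sum_infsum)
  moreover have "infsum ?q T = measure_pmf.prob (gw_tree c L) T"
    by (simp only: measure_pmf_conv_infsetsum infsetsum_infsum pmf_abs_summable)
  ultimately have "(sum ?q \<longlongrightarrow> measure_pmf.prob (gw_tree c L) T) (finite_subsets_at_top T)"
    by (simp add: has_sum_def)
  then have "\<forall>\<^sub>F F in finite_subsets_at_top T. measure_pmf.prob (gw_tree c L) T - \<eta> / 2 < sum ?q F"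
    by (rule order_tendstoD(1)) (use assms in simp)
  then obtain F where F: "finite F" "F \<subseteq> T" "measure_pmf.prob (gw_tree c L) T - \<eta> / 2 < sum ?q F"
    unfolding eventually_finite_subsets_at_top by blast
  \<comment> \<open>Higher trees have probability \<open>0\<close>, and the height bound is what
    makes the tree seen by a root unique, hence the events disjoint.\<close>
  define G where "G = {t \<in> F. height_le L t}"
  have G: "finite G" "G \<subseteq> T" "\<And>t. t \<in> G \<Longrightarrow> height_le L t" using F by (auto simp: G_def)
  have FG: "sum ?q F = sum ?q G"
    using F(1) by (intro sum.mono_neutral_right) (auto simp: G_def pmf_gw_tree)
  define \<epsilon> where "\<epsilon> = \<eta> / (2 * (real (card G) + 1))"
  have \<epsilon>: "0 < \<epsilon>" "real (card G) * \<epsilon> \<le> \<eta> / 2" using assms by (auto simp: \<epsilon>_def field_simps)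
  have "\<forall>\<^sub>F n in sequentially. \<forall>t\<in>G. ?q t - \<epsilon> \<le> ?P n (?A n t)"
    using G by (intro eventually_ball_finite ballI planar_occ_lower_bound \<epsilon>(1)) auto
  then show ?thesis
  proof eventually_elim
    case (elim n)
    have "measure_pmf.prob (gw_tree c L) T - \<eta> \<le> sum ?q G - real (card G) * \<epsilon>"
      using F(3) \<epsilon>(2) unfolding FG by linarith
    also have "\<dots> = (\<Sum>t\<in>G. ?q t - \<epsilon>)" by (simp add: sum_subtractf)
    also have "\<dots> \<le> (\<Sum>t\<in>G. ?P n (?A n t))" using elim by (intro sum_mono) auto
    also have "\<dots> = ?P n (\<Union>t\<in>G. ?A n t)"
    proof (rule measure_pmf.finite_measure_finite_Union[symmetric])
      show "disjoint_family_on (?A n) G"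
        unfolding disjoint_family_on_def
      proof (intro ballI impI)
        fix t t' assume t: "t \<in> G" "t' \<in> G" "t \<noteq> t'"
        show "?A n t \<inter> ?A n t' = {}" using occ_unique[OF _ _ G(3)[OF t(1)] G(3)[OF t(2)]] t(3) by blast
      qed
    qed (use G(1) in auto)
    also have "\<dots> \<le> ?P n {(E, r). \<exists>t\<in>T. height_le L t \<and> r \<in> occ L t {1..n} E}"
      using G(2,3) by (intro measure_pmf.finite_measure_mono) auto
    finally show ?case .
  qed
qed

text \<open>The upper bound is the lower bound for the complementary set of trees. Roots that see no
  tree lie in neither event, and the two lower bounds leave them no mass in the limit. Depth
  \<open>Suc l\<close> is used because an exploration determines balls of smaller radius
  only.\<close>

lemma planar_ball_prob_limit: "(\<lambda>n. planar_ball_prob n (m n) l H s) \<longlonglongrightarrow> gw_ball_prob c l H s"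
proof -
  let ?L = "Suc l"
  let ?T = "{t. rooted_iso (ball (tree_graph t) [] l) [] H s}"
  let ?P = "\<lambda>n. measure_pmf.prob (pmf_of_set (planar_graphs n (m n) \<times> {1..n}))"
  let ?I = "\<lambda>n. {(E, r). rooted_iso (ball ({1..n}, E) r l) r H s}"
  have lower: "\<forall>\<^sub>F n in sequentially. gw_ball_prob c l H s - \<eta> \<le> planar_ball_prob n (m n) l H s" if "0 < \<eta>" for \<eta>
    using planar_trees_lower_bound[OF that, of ?L ?T]
  proof eventually_elim
    case (elim n)
    have "?P n {(E, r). \<exists>t\<in>?T. height_le ?L t \<and> r \<in> occ ?L t {1..n} E} \<le> ?P n (?I n)"
      using occ_ball_iso_iff[of _ ?L _ "{1..n}" _ l H s] by (intro measure_pmf.finite_measure_mono) auto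
    then show ?case using elim unfolding gw_ball_prob_eq planar_ball_prob_def by linarith
  qed
  have upper: "\<forall>\<^sub>F n in sequentially. planar_ball_prob n (m n) l H s \<le> gw_ball_prob c l H s + \<eta>" if "0 < \<eta>" for \<eta>
    using planar_trees_lower_bound[OF that, of ?L "- ?T"]
  proof eventually_elim
    case (elim n)
    have "?P n {(E, r). \<exists>t\<in>- ?T. height_le ?L t \<and> r \<in> occ ?L t {1..n} E} \<le> ?P n (- ?I n)"
      using occ_ball_iso_iff[of _ ?L _ "{1..n}" _ l H s] by (intro measure_pmf.finite_measure_mono) auto
    moreover have "?P n (- ?I n) = 1 - ?P n (?I n)"
      using measure_pmf.prob_compl[of "?I n" "pmf_of_set (planar_graphs n (m n) \<times> {1..n})"]
      by (simp add: Compl_eq_Diff_UNIV)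
    moreover have "measure_pmf.prob (gw_tree c ?L) (- ?T) = 1 - measure_pmf.prob (gw_tree c ?L) ?T"
      using measure_pmf.prob_compl[of ?T "gw_tree c ?L"] by (simp add: Compl_eq_Diff_UNIV)
    ultimately show ?case using elim unfolding gw_ball_prob_eq planar_ball_prob_def by linarith
  qed
  show ?thesis
  proof (rule tendstoI)
    fix e :: real assume "0 < e"
    then have "0 < e / 2" by simp
    from lower[OF this] upper[OF this]
    show "\<forall>\<^sub>F n in sequentially. dist (planar_ball_prob n (m n) l H s) (gw_ball_prob c l H s) < e"
      by eventually_elim (use \<open>0 < e\<close> in \<open>simp add: dist_real_def abs_less_iff\<close>)
  qed
qed

end

theorem theorem1p3:
  fixes m :: "nat \<Rightarrow> nat" and c :: real
  assumes "\<exists>C. \<forall>\<^sub>F n in sequentially. real (m n) \<le> real n / 2 + C * real n powr (2/3)"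
    and "c \<in> {0..1}"
    and "(\<lambda>n. 2 * real (m n) / real n) \<longlonglongrightarrow> c"
  shows "\<forall>(H :: nat graph) s l. simple_graph H \<and> finite (fst H) \<and> s \<in> fst H \<longrightarrow>
           (\<lambda>n. planar_ball_prob n (m n) l H s) \<longlonglongrightarrow> gw_ball_prob c l H s"
  using planar_ball_prob_limit[OF _ _ assms(3) refl] assms(2) by auto

end
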